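(* Let $\varrho$ be a primitive inflation rule in $\mathbb R^d$, with finitely many translational prototiles and expansive linear map $Q$. Let $B(k)$ be the corresponding Fourier matrix, with $\det(B(k))\neq0$ for at least one $k\in\mathbb R^d$. If there is an $\varepsilon>0$ such that $$\chi^B(k)\,\leqslant\,\log\sqrt{|\det(Q)|}\,-\varepsilon$$ holds for Lebesgue-a.e. $k\in\mathbb R^d$, where $\chi^B(k)$ is the maximal Lyapunov exponent of the Fourier matrix cocycle, then the diffraction measure of the system cannot have an absolutely continuous part.
   Context: Inflation rule (stone inflation): $n_a$ prototiles $\mathcal T_1,\dots,\mathcal T_{n_a}$ in $\mathbb R^d$ (tiles up to translation) and an expansive linear map $Q$ such that each $Q(\mathcal T_j)$ is a union of non-overlapping translates of prototiles, as specified by the rule $\varrho$. It is primitive if the incidence matrix $M$, with $M_{ij}$ the number of tiles of type $i$ in the supertile of type $j$, is primitive. The hull $\mathbb Y$ is the orbit closure (in the local rubber topology, which reduces to the local topology in the case of finite local complexity (FLC); FLC is not assumed) of a tiling fixed by $\varrho$ or by a power of it, under the translation action of $\mathbb R^d$; the system $(\mathbb Y,\mathbb R^d)$ is strictly ergodic. Each prototile carries a control point, chosen such that every tiling in $\mathbb Y$ is mutually locally derivable (MLD) with the corresponding set $\Lambda=\bigcup_i\Lambda_i$ of control points, coloured by tile type ($\Lambda_i$ being those of tiles of type $i$); tilings are identified with these coloured point sets. Displacement and Fourier matrices: $T_{ij}$ is the set of control point positions of tiles of type $i$ in the supertile of type $j$, relative to the control point of that supertile, where control points of supertiles are the images of those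 of the tiles under $Q$ (so, if all prototiles have their control point at $0$, then $Q(\mathcal T_j)=\bigcup_i\bigcup_{t\in T_{ij}}(t+\mathcal T_i)$). $B_{ij}(k)=\sum_{t\in T_{ij}}\mathrm e^{2\pi\mathrm i\,t\cdot k}$ for $k\in\mathbb R^d$, $B^{(n)}(k)=B(k)B(Q^Tk)\cdots B((Q^T)^{n-1}k)$, and $\chi^B(k)=\limsup_{n\to\infty}\frac1n\log\|B^{(n)}(k)\|$ with any matrix norm. Diffraction: the pair correlation measures are $\Upsilon_{ij}=\lim_{r\to\infty}\frac{1}{\operatorname{dens}(\Lambda)\operatorname{vol}(B_r)}\sum_{x\in\Lambda_i\cap B_r,\,y\in\Lambda_j\cap B_r}\delta_{y-x}$ (vague limit, $B_r$ the ball of radius $r$ around $0$), which exist and do not depend on $\Lambda\in\mathbb Y$. The weighted Dirac comb $\sum_iu_i\delta_{\Lambda_i}$ with weights $u\in\mathbb C^{n_a}$ has autocorrelation $\gamma_u=\operatorname{dens}(\Lambda)\sum_{i,j}\overline{u_i}\Upsilon_{ij}u_j$ and diffraction measure $\widehat{\gamma_u}$ (a positive measure). The conclusion means that the absolutely continuous part of $\widehat{\gamma_u}$ in the Lebesgue decomposition vanishes for every choice of $u$. *)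

theory Defs
  imports "HOL-Analysis.Analysis"
begin

text \<open>
  The finite type \<open>'n\<close> indexes the prototiles.  A prototile is an index \<open>i\<close> (its type) together
  with its support \<open>T i\<close>, so distinct prototiles may have the same shape.  A placed tile is a pair
  \<open>(i, s)\<close>, standing for the translate \<open>s + T i\<close> of type \<open>i\<close>; tilings and patches are sets of
  placed tiles.
\<close>

type_synonym ('n, 'd) patch = "('n \<times> (real ^ 'd)) set"

definition tile :: "('n \<Rightarrow> (real ^ 'd) set) \<Rightarrow> 'n \<times> (real ^ 'd) \<Rightarrow> (real ^ 'd) set" where
  "tile T p = (+) (snd p) ` T (fst p)"

definition shift :: "real ^ 'd \<Rightarrow> ('n, 'd) patch \<Rightarrow> ('n, 'd) patch" where
  "shift v W = (\<lambda>(i, s). (i, v + s)) ` W"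

definition nonoverlapping :: "('n \<Rightarrow> (real ^ 'd) set) \<Rightarrow> ('n, 'd) patch \<Rightarrow> bool" where
  "nonoverlapping T P \<longleftrightarrow>
     pairwise (\<lambda>p q. interior (tile T p) \<inter> interior (tile T q) = {}) P"

definition tiling :: "('n \<Rightarrow> (real ^ 'd) set) \<Rightarrow> ('n, 'd) patch \<Rightarrow> bool" where
  "tiling T W \<longleftrightarrow> nonoverlapping T W \<and> (\<Union>p\<in>W. tile T p) = UNIV"

definition expansive :: "real ^ 'd ^ 'd \<Rightarrow> bool" where
  "expansive Q \<longleftrightarrow>
     (\<forall>(l :: complex) v. v \<noteq> 0 \<and> (\<chi> i j. complex_of_real (Q $ i $ j)) *v v = l *s v
        \<longrightarrow> norm l > 1)"

text \<open>
  The rule \<open>\<rho>\<close> is recorded as the set \<open>\<rho> j\<close> of placed tiles into which \<open>Q (T j)\<close> is dissected.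
\<close>

definition inflation_rule ::
  "real ^ 'd ^ 'd \<Rightarrow> ('n \<Rightarrow> (real ^ 'd) set) \<Rightarrow> ('n \<Rightarrow> ('n, 'd) patch) \<Rightarrow> bool" where
  "inflation_rule Q T \<rho> \<longleftrightarrow> expansive Q \<and>
     (\<forall>i. T i \<noteq> {} \<and> compact (T i) \<and> closure (interior (T i)) = T i) \<and>
     (\<forall>j. finite (\<rho> j) \<and> nonoverlapping T (\<rho> j) \<and> (*v) Q ` T j = (\<Union>p\<in>\<rho> j. tile T p))"

definition incidence_matrix :: "('n \<Rightarrow> ('n, 'd) patch) \<Rightarrow> nat ^ 'n ^ 'n" where
  "incidence_matrix \<rho> = (\<chi> i j. card {s. (i, s) \<in> \<rho> j})"

definition primitive_matrix :: "nat ^ 'n ^ 'n \<Rightarrow> bool" where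
  "primitive_matrix M \<longleftrightarrow> (\<exists>k>0. \<forall>i j. (((**) M ^^ k) (mat 1)) $ i $ j > 0)"

definition inflate ::
  "real ^ 'd ^ 'd \<Rightarrow> ('n \<Rightarrow> ('n, 'd) patch) \<Rightarrow> ('n, 'd) patch \<Rightarrow> ('n, 'd) patch" where
  "inflate Q \<rho> W = (\<Union>(j, s)\<in>W. shift (Q *v s) (\<rho> j))"

text \<open>
  Legality (every finite patch occurs, up to translation, in an iterated inflation of a single
  tile) is what makes the orbit closure of a tiling fixed by a power of the rule minimal:
  for \<open>a \<mapsto> aba\<close>, \<open>b \<mapsto> bab\<close>, the seed \<open>a|a\<close> grows to a fixed, but not legal, tiling whose orbit
  closure is not minimal.
\<close>

definition legal ::
  "real ^ 'd ^ 'd \<Rightarrow> ('n \<Rightarrow> ('n, 'd) patch) \<Rightarrow> ('n, 'd) patch \<Rightarrow> bool" where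
  "legal Q \<rho> W \<longleftrightarrow>
     (\<forall>P. finite P \<and> P \<subseteq> W \<longrightarrow> (\<exists>n j v. shift v P \<subseteq> (inflate Q \<rho> ^^ n) {(j, 0)}))"

definition inflation_tiling ::
  "real ^ 'd ^ 'd \<Rightarrow> ('n \<Rightarrow> (real ^ 'd) set) \<Rightarrow> ('n \<Rightarrow> ('n, 'd) patch) \<Rightarrow> ('n, 'd) patch \<Rightarrow> bool"
  where
  "inflation_tiling Q T \<rho> W \<longleftrightarrow>
     tiling T W \<and> legal Q \<rho> W \<and> (\<exists>m>0. (inflate Q \<rho> ^^ m) W = W)"

text \<open>
  The control point of the prototile \<open>T i\<close> is \<open>c i\<close>, that of the placed tile \<open>(i, s)\<close> is \<open>s + c i\<close>.
  The coloured control point set of a tiling is the family of its monochromatic parts.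
\<close>

definition control_points ::
  "('n \<Rightarrow> real ^ 'd) \<Rightarrow> ('n, 'd) patch \<Rightarrow> 'n \<Rightarrow> (real ^ 'd) set" where
  "control_points c W i = {s + c i | s. (i, s) \<in> W}"

text \<open>
  The entourages of the local rubber topology on coloured point sets: within the ball of radius
  \<open>1/e\<close> around \<open>0\<close>, the sets agree after moving every point separately by less than \<open>e\<close>.
\<close>

definition rubber_close ::
  "real \<Rightarrow> ('n \<Rightarrow> (real ^ 'd) set) \<Rightarrow> ('n \<Rightarrow> (real ^ 'd) set) \<Rightarrow> bool" where
  "rubber_close e \<Lambda> \<Lambda>' \<longleftrightarrow>
     (\<forall>i. \<Lambda> i \<inter> cball 0 (1 / e) \<subseteq> (\<Union>y\<in>\<Lambda>' i. ball y e) \<and>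
          \<Lambda>' i \<inter> cball 0 (1 / e) \<subseteq> (\<Union>y\<in>\<Lambda> i. ball y e))"

definition tiling_hull ::
  "('n \<Rightarrow> (real ^ 'd) set) \<Rightarrow> ('n \<Rightarrow> real ^ 'd) \<Rightarrow> ('n, 'd) patch \<Rightarrow> ('n, 'd) patch set" where
  "tiling_hull T c W\<^sub>0 =
     {W. tiling T W \<and>
         (\<forall>e>0. \<exists>v. rubber_close e (control_points c W) (control_points c (shift v W\<^sub>0)))}"

text \<open>
  Mutual local derivability of a tiling and a coloured point set: what is seen at a position of
  one of them is determined, up to translation, by a neighbourhood of fixed radius in the other.
\<close>

definition patch_at ::
  "('n \<Rightarrow> (real ^ 'd) set) \<Rightarrow> real \<Rightarrow> ('n, 'd) patch \<Rightarrow> real ^ 'd \<Rightarrow> ('n, 'd) patch" where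
  "patch_at T R W x = {p \<in> shift (- x) W. tile T p \<inter> cball 0 R \<noteq> {}}"

definition points_at ::
  "real \<Rightarrow> ('n \<Rightarrow> (real ^ 'd) set) \<Rightarrow> real ^ 'd \<Rightarrow> 'n \<Rightarrow> (real ^ 'd) set" where
  "points_at R \<Lambda> x i = (+) (- x) ` \<Lambda> i \<inter> cball 0 R"

definition MLD ::
  "('n \<Rightarrow> (real ^ 'd) set) \<Rightarrow> ('n, 'd) patch \<Rightarrow> ('n \<Rightarrow> (real ^ 'd) set) \<Rightarrow> bool" where
  "MLD T W \<Lambda> \<longleftrightarrow>
     (\<exists>R>0. \<forall>x y. patch_at T R W x = patch_at T R W y \<longrightarrow> points_at 0 \<Lambda> x = points_at 0 \<Lambda> y) \<and>
     (\<exists>R>0. \<forall>x y. points_at R \<Lambda> x = points_at R \<Lambda> y \<longrightarrow> patch_at T 0 W x = patch_at T 0 W y)"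

definition admissible_control_points ::
  "('n \<Rightarrow> (real ^ 'd) set) \<Rightarrow> ('n \<Rightarrow> real ^ 'd) \<Rightarrow> ('n, 'd) patch \<Rightarrow> bool" where
  "admissible_control_points T c W\<^sub>0 \<longleftrightarrow>
     (\<forall>W\<in>tiling_hull T c W\<^sub>0. disjoint_family (control_points c W) \<and> MLD T W (control_points c W))"

text \<open>
  The supertile \<open>Q (T j)\<close> has control point \<open>Q (c j)\<close>, and its placed tiles \<open>(i, s)\<close> have control
  points \<open>s + c i\<close>.
\<close>

definition displacements ::
  "real ^ 'd ^ 'd \<Rightarrow> ('n \<Rightarrow> ('n, 'd) patch) \<Rightarrow> ('n \<Rightarrow> real ^ 'd) \<Rightarrow> 'n \<Rightarrow> 'n \<Rightarrow> (real ^ 'd) set" where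
  "displacements Q \<rho> c i j = {(s + c i) - Q *v c j | s. (i, s) \<in> \<rho> j}"

definition fourier_matrix ::
  "real ^ 'd ^ 'd \<Rightarrow> ('n \<Rightarrow> ('n, 'd) patch) \<Rightarrow> ('n \<Rightarrow> real ^ 'd) \<Rightarrow> real ^ 'd \<Rightarrow> complex ^ 'n ^ 'n" where
  "fourier_matrix Q \<rho> c k =
     (\<chi> i j. \<Sum>t\<in>displacements Q \<rho> c i j. exp (2 * pi * \<i> * complex_of_real (t \<bullet> k)))"

primrec cocycle ::
  "real ^ 'd ^ 'd \<Rightarrow> (real ^ 'd \<Rightarrow> complex ^ 'n ^ 'n) \<Rightarrow> nat \<Rightarrow> real ^ 'd \<Rightarrow> complex ^ 'n ^ 'n" where
  "cocycle Q B 0 k = mat 1"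
| "cocycle Q B (Suc n) k = B k ** cocycle Q B n (transpose Q *v k)"

text \<open>The exponent is \<open>- \<infinity>\<close> where the cocycle vanishes; \<open>norm\<close> is the Frobenius norm.\<close>

definition lyapunov_exponent ::
  "real ^ 'd ^ 'd \<Rightarrow> (real ^ 'd \<Rightarrow> complex ^ 'n ^ 'n) \<Rightarrow> real ^ 'd \<Rightarrow> ereal" where
  "lyapunov_exponent Q B k =
     limsup (\<lambda>n. if cocycle Q B n k = 0 then - \<infinity>
                 else ereal (1 / real n * ln (norm (cocycle Q B n k))))"

definition dens :: "(real ^ 'd) set \<Rightarrow> real" where
  "dens S = Lim at_top (\<lambda>r. real (card (S \<inter> ball 0 r)) / measure lborel (ball (0 :: real ^ 'd) r))"

definition Cc :: "(real ^ 'd \<Rightarrow> complex) \<Rightarrow> bool" where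
  "Cc f \<longleftrightarrow> continuous_on UNIV f \<and> compact (closure {x. f x \<noteq> 0})"

definition radon_measure :: "(real ^ 'd) measure \<Rightarrow> bool" where
  "radon_measure \<mu> \<longleftrightarrow> sets \<mu> = sets borel \<and> (\<forall>K. compact K \<longrightarrow> emeasure \<mu> K < \<infinity>)"

definition is_pair_correlation ::
  "('n \<Rightarrow> (real ^ 'd) set) \<Rightarrow> 'n \<Rightarrow> 'n \<Rightarrow> (real ^ 'd) measure \<Rightarrow> bool" where
  "is_pair_correlation \<Lambda> i j \<mu> \<longleftrightarrow> radon_measure \<mu> \<and>
     (\<forall>f. Cc f \<longrightarrow>
        ((\<lambda>r. (\<Sum>x\<in>\<Lambda> i \<inter> ball 0 r. \<Sum>y\<in>\<Lambda> j \<inter> ball 0 r. f (y - x)) /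
              complex_of_real (dens (\<Union>l. \<Lambda> l) * measure lborel (ball (0 :: real ^ 'd) r)))
          \<longlongrightarrow> (\<integral>z. f z \<partial>\<mu>)) at_top)"

text \<open>The autocorrelation is a complex Radon measure, given as a linear functional on \<open>Cc\<close>.\<close>

definition autocorrelation ::
  "real \<Rightarrow> ('n::finite \<Rightarrow> 'n \<Rightarrow> (real ^ 'd) measure) \<Rightarrow> ('n \<Rightarrow> complex) \<Rightarrow> (real ^ 'd \<Rightarrow> complex) \<Rightarrow> complex"
  where
  "autocorrelation \<delta> \<Upsilon> u f =
     complex_of_real \<delta> * (\<Sum>i\<in>UNIV. \<Sum>j\<in>UNIV. cnj (u i) * (\<integral>z. f z \<partial>\<Upsilon> i j) * u j)"

definition inverse_fourier :: "(real ^ 'd \<Rightarrow> complex) \<Rightarrow> real ^ 'd \<Rightarrow> complex" where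
  "inverse_fourier f k = (\<integral>x. exp (2 * pi * \<i> * complex_of_real (k \<bullet> x)) * f x \<partial>lborel)"

definition self_convolution :: "(real ^ 'd \<Rightarrow> complex) \<Rightarrow> real ^ 'd \<Rightarrow> complex" where
  "self_convolution f x = (\<integral>y. f y * cnj (f (y - x)) \<partial>lborel)"

text \<open>
  Fourier transform of a measure in the sense of Argabright and Gil de Lamadrid: the positive
  measure \<open>\<mu>\<close> is the transform of \<open>\<gamma>\<close> if \<open>\<gamma> (f * f~)\<close> is the \<open>\<mu>\<close>-integral of the squared modulus of
  the inverse Fourier transform of \<open>f\<close>, for every \<open>f\<close> in \<open>Cc\<close>, with \<open>f~ x = cnj (f (- x))\<close>.
\<close>

definition is_fourier_transform ::
  "((real ^ 'd \<Rightarrow> complex) \<Rightarrow> complex) \<Rightarrow> (real ^ 'd) measure \<Rightarrow> bool" where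
  "is_fourier_transform \<gamma> \<mu> \<longleftrightarrow> radon_measure \<mu> \<and>
     (\<forall>f. Cc f \<longrightarrow>
        integrable \<mu> (\<lambda>k. (norm (inverse_fourier f k))\<^sup>2) \<and>
        complex_of_real (\<integral>k. (norm (inverse_fourier f k))\<^sup>2 \<partial>\<mu>) = \<gamma> (self_convolution f))"

definition lebesgue_decomposition ::
  "(real ^ 'd) measure \<Rightarrow> (real ^ 'd) measure \<Rightarrow> (real ^ 'd) measure \<Rightarrow> bool" where
  "lebesgue_decomposition \<mu> \<alpha> \<sigma> \<longleftrightarrow> sets \<alpha> = sets borel \<and> sets \<sigma> = sets borel \<and>
     (\<forall>A\<in>sets borel. emeasure \<mu> A = emeasure \<alpha> A + emeasure \<sigma> A) \<and>
     absolutely_continuous lborel \<alpha> \<and>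
     (\<exists>N\<in>null_sets lborel. emeasure \<sigma> (- N) = 0)"

definition ac_part :: "(real ^ 'd) measure \<Rightarrow> (real ^ 'd) measure" where
  "ac_part \<mu> = (THE \<alpha>. \<exists>\<sigma>. lebesgue_decomposition \<mu> \<alpha> \<sigma>)"

end

theory Submission
  imports Defs
begin

text \<open>
  Let \<open>Q\<close>, \<open>B\<close> and \<open>M\<close> belong to a power of the inflation that fixes \<open>W\<^sub>0\<close>, where \<open>M\<close> is the sum of
  the \<open>(card T\<^sub>i\<^sub>j)\<^sup>2\<close>.  Convolution by finite sums of point masses turns \<open>1 - \<parallel>B(k)\<parallel>\<^sup>2 / M\<close> into a
  self-adjoint operator \<open>0 \<le> Y \<le> 1\<close> on test functions \<open>f\<close>, and convexity of the moments of \<open>Y\<close> gives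
  \<open>\<Sum> \<parallel>B\<^sub>i\<^sub>j Y\<^sup>N f\<parallel>\<^sup>2 \<le> M \<parallel>f\<parallel>\<^sup>2 / (2 N + 1)\<close>.  Decomposing the control points in a large ball into
  supertiles, this bounds the integral of \<open>(1 - \<parallel>B(k)\<parallel>\<^sup>2 / M)\<^sup>2\<^sup>N\<close> times \<open>\<bar>f\<^sup>\<or>\<bar>\<^sup>2\<close> against the diffraction by
  \<open>C M / (\<bar>det Q\<bar> (2 N + 1))\<close>, with \<open>C\<close> independent of the power and of \<open>N\<close>.  A suitable \<open>N\<close> shows that
  the diffraction of \<open>{k. \<parallel>B(k)\<parallel>\<^sup>2 \<le> \<eta> \<bar>det Q\<bar>}\<close>, weighted by \<open>\<bar>f\<^sup>\<or>\<bar>\<^sup>2\<close>, is \<open>O(\<eta>)\<close>.  By the bound on the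
  Lyapunov exponent, Lebesgue-almost every \<open>k\<close> lies in these sets for all large powers, with \<open>\<eta>\<close>
  exponentially small, so the diffraction lives on a Lebesgue null set.
\<close>

text \<open>The cut-off to frequencies with small Fourier matrix must be built from finitely many
  convolutions, since correlations are tested only against \<open>Cc\<close> functions. The
  polynomial (1 - x)^(2N) in x = |B(k)|^2 / M is such a cut-off. The gain is self-similarity: the
  control points are displaced copies of the supertile points, so the comb already carries a factor
  B(k), and the damped comb involves M x (1 - x)^(2N), which is at most M / (2N + 1). Supertile
  points are sparser by the factor |det Q|, which supplies the remaining denominator. On the target
  set x is at most \<theta> = \<eta> |det Q| / M, so about 1 / (4 \<theta>) damping steps do little
  harm there, and for this N the bound becomes a multiple of \<eta>. Thus M cancels, however fast it
  grows with the power. All estimates concern square integrals of sums of translates; the spectral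
  inequality for x (1 - x)^(2N) enters through moments, so no Plancherel theorem is involved. As the
  final constant has to serve all powers at once, the geometric constants behind it come from the
  prototiles alone.\<close>

section \<open>Volumes of linear images\<close>

text \<open>
  \<open>measure_linear_image\<close> of the library, but without an order on the index type.
\<close>

lemma measure_matrix_image:
  fixes A :: "real ^ 'n ^ 'n"
  assumes "S \<in> lmeasurable"
  shows "(*v) A ` S \<in> lmeasurable \<and> measure lebesgue ((*v) A ` S) = \<bar>det A\<bar> * measure lebesgue S"
proof -
  define P where "P A \<longleftrightarrow> (\<forall>S\<in>lmeasurable. (*v) A ` S \<in> lmeasurable \<and>
    measure lebesgue ((*v) A ` S) = \<bar>det A\<bar> * measure lebesgue S)" for A :: "real ^ 'n ^ 'n"
  have unimodular: "P A"
    if "\<bar>det A\<bar> = 1" "\<And>a b. cbox a b \<noteq> {} \<Longrightarrow> measure lebesgue ((*v) A ` cbox a b) = measure lebesgue (cbox a b)"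
    for A :: "real ^ 'n ^ 'n"
  proof -
    have "measure lebesgue ((*v) A ` cbox a b) = 1 * measure lebesgue (cbox a b)" for a b
      using that(2)[of a b] by (cases "cbox a b = {}") auto
    then have "(*v) A ` S \<in> lmeasurable \<and> 1 * measure lebesgue S = measure lebesgue ((*v) A ` S)"
      if "S \<in> lmeasurable" for S
      using that by (intro measure_linear_sufficient matrix_vector_mul_linear)
    then show ?thesis unfolding P_def using that(1) by metis
  qed
  have "P A"
  proof (rule induct_matrix_elementary_alt)
    fix A B :: "real ^ 'n ^ 'n"
    assume "P A" "P B"
    moreover have "(*v) (A ** B) ` S = (*v) A ` (*v) B ` S" for S
      by (simp add: image_image matrix_vector_mul_assoc)
    ultimately show "P (A ** B)" unfolding P_def by (simp add: det_mul abs_mult)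
  next
    fix A :: "real ^ 'n ^ 'n" and i
    assume "row i A = 0"
    then have det: "det A = 0" by (rule det_zero_row)
    then have "\<not> inj ((*v) A)"
      using det_nz_iff_inj[of "(*v) A"] by simp
    then have "negligible ((*v) A ` S)" for S by (intro negligible_linear_singular_image) auto
    then show "P A" unfolding P_def by (simp add: det negligible_imp_measure0 negligible_imp_measurable)
  next
    fix A :: "real ^ 'n ^ 'n"
    assume diag: "\<And>i j. i \<noteq> j \<Longrightarrow> A $ i $ j = 0"
    have "(\<Sum>j\<in>UNIV. A $ i $ j * x $ j) = A $ i $ i * x $ i" for x and i :: 'n
      using diag by (subst sum.remove[of _ i]) auto
    then have "(*v) A = (\<lambda>x. \<chi> i. A $ i $ i * x $ i)"
      by (simp add: matrix_vector_mult_def fun_eq_iff)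
    then show "P A"
      unfolding P_def using diag by (simp add: measurable_stretch measure_stretch det_diagonal)
  next
    fix m n :: 'n
    let ?\<tau> = "Transposition.transpose m n"
    let ?A = "\<chi> i j. (mat 1 :: real ^ 'n ^ 'n) $ i $ ?\<tau> j"
    have "(\<Sum>j\<in>UNIV. (if i = ?\<tau> j then 1 else 0) * x $ j) = x $ ?\<tau> i" for x :: "real ^ 'n" and i
    proof -
      have "(\<Sum>j\<in>UNIV. (if i = ?\<tau> j then 1 else 0) * x $ j) = (\<Sum>j\<in>UNIV. if ?\<tau> i = j then x $ j else 0)"
        by (intro sum.cong) (auto simp: transpose_eq_iff)
      then show ?thesis by simp
    qed
    then have A: "(*v) ?A = (\<lambda>x. \<chi> i. x $ ?\<tau> i)"
      by (simp add: matrix_vector_mult_def mat_def fun_eq_iff)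
    show "P ?A"
    proof (rule unimodular)
      show "\<bar>det ?A\<bar> = 1" by (simp add: det_permute_columns permutes_swap_id sign_swap_id abs_mult)
      fix a b :: "real ^ 'n" assume ne: "cbox a b \<noteq> {}"
      have box: "(*v) ?A ` cbox a b = cbox (\<chi> i. a $ ?\<tau> i) (\<chi> i. b $ ?\<tau> i)"
      proof (intro set_eqI iffI)
        fix x assume x: "x \<in> cbox (\<chi> i. a $ ?\<tau> i) (\<chi> i. b $ ?\<tau> i)"
        then have "a $ ?\<tau> (?\<tau> i) \<le> x $ ?\<tau> i \<and> x $ ?\<tau> i \<le> b $ ?\<tau> (?\<tau> i)" for i
          unfolding mem_box_cart vec_lambda_beta by blast
        then have "(\<chi> i. x $ ?\<tau> i) \<in> cbox a b" by (simp add: mem_box_cart)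
        moreover have "x = (*v) ?A (\<chi> i. x $ ?\<tau> i)" by (simp add: A vec_eq_iff)
        ultimately show "x \<in> (*v) ?A ` cbox a b" by blast
      qed (auto simp: A mem_box_cart)
      have "(\<Prod>i\<in>UNIV. b $ ?\<tau> i - a $ ?\<tau> i) = (\<Prod>i\<in>UNIV. b $ i - a $ i)"
        by (rule prod.reindex_bij_betw[of ?\<tau> UNIV UNIV "\<lambda>i. b $ i - a $ i"]) simp
      moreover have "cbox (\<chi> i. a $ ?\<tau> i) (\<chi> i. b $ ?\<tau> i) \<noteq> {}" using ne unfolding box[symmetric] by blast
      ultimately show "measure lebesgue ((*v) ?A ` cbox a b) = measure lebesgue (cbox a b)"
        using ne unfolding box by (simp add: content_cbox_cart)
    qed
  next
    fix m n :: 'n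
    assume mn: "m \<noteq> n"
    let ?A = "(\<chi> i j. of_bool (i = m \<and> j = n \<or> i = j)) :: real ^ 'n ^ 'n"
    have A: "(*v) ?A = (\<lambda>x. \<chi> i. if i = m then x $ m + x $ n else x $ i)"
    proof -
      have "(\<Sum>j\<in>UNIV. of_bool (i = m \<and> j = n \<or> i = j) * x $ j) = (if i = m then x $ m + x $ n else x $ i)"
        for x :: "real ^ 'n" and i
      proof -
        have "(\<Sum>j\<in>UNIV. of_bool (i = m \<and> j = n \<or> i = j) * x $ j)
          = (\<Sum>j\<in>UNIV. (if j = i then x $ j else 0) + (if j = n then if i = m then x $ j else 0 else 0))"
          using mn by (intro sum.cong) auto
        then show ?thesis by (simp add: sum.distrib)
      qed
      then show ?thesis by (simp add: matrix_vector_mult_def fun_eq_iff)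
    qed
    show "P ?A"
    proof (rule unimodular)
      have "?A = (\<chi> k. if k = m then row m (mat 1) + 1 *s row n (mat 1) else row k (mat 1))"
        using mn by (auto simp: vec_eq_iff row_def mat_def)
      then show "\<bar>det ?A\<bar> = 1" 
        using det_row_operation[OF mn, of "mat 1 :: real ^ 'n ^ 'n" 1] by (metis abs_one det_I)
      fix a b :: "real ^ 'n" assume ne: "cbox a b \<noteq> {}"
      \<comment> \<open>\<open>measure_shear_interval\<close> asks for a nonnegative lower bound in
        coordinate \<open>n\<close>. The box is therefore moved to the corner 0, and the translation
        is pulled through the linear map.\<close>
      have ne0: "cbox 0 (b - a) \<noteq> {}" using ne by (simp add: interval_ne_empty_cart)
      have "cbox a b = (+) a ` cbox 0 (b - a)" using cbox_translation[of a 0 "b - a"] by simp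
      then have "(*v) ?A ` cbox a b = (+) (?A *v a) ` (*v) ?A ` cbox 0 (b - a)"
        by (simp add: image_image matrix_vector_right_distrib)
      then have "measure lebesgue ((*v) ?A ` cbox a b) = measure lebesgue ((*v) ?A ` cbox 0 (b - a))"
        by (simp only: measure_translation)
      also have "\<dots> = measure lebesgue (cbox 0 (b - a))"
        unfolding A by (rule measure_shear_interval[OF mn ne0]) simp
      also have "\<dots> = measure lebesgue (cbox a b)"
        using \<open>cbox a b = _\<close> by (simp only: measure_translation)
      finally show "measure lebesgue ((*v) ?A ` cbox a b) = measure lebesgue (cbox a b)" .
    qed
  qed
  then show ?thesis using assms unfolding P_def by blast
qed

section \<open>Powers of an inflation rule\<close>

definition regular_prototiles :: "('n \<Rightarrow> (real ^ 'd) set) \<Rightarrow> bool" where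
  "regular_prototiles T \<longleftrightarrow> (\<forall>i. T i \<noteq> {} \<and> compact (T i) \<and> closure (interior (T i)) = T i)"

text \<open>Invertibility stands in for expansiveness so that the class is closed under composition
  and contains the trivial rule with \<open>mat 1\<close>. The main estimates can then be proved
  once for all powers of a rule.\<close>

definition dissection ::
  "real ^ 'd ^ 'd \<Rightarrow> ('n \<Rightarrow> (real ^ 'd) set) \<Rightarrow> ('n \<Rightarrow> ('n, 'd) patch) \<Rightarrow> bool" where
  "dissection Q T \<rho> \<longleftrightarrow> invertible Q \<and>
     (\<forall>j. finite (\<rho> j) \<and> nonoverlapping T (\<rho> j) \<and> (*v) Q ` T j = (\<Union>p\<in>\<rho> j. tile T p))"

lemma expansive_imp_invertible:
  fixes Q :: "real ^ 'd ^ 'd"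
  assumes "expansive Q"
  shows "invertible Q"
proof -
  have "x = 0" if "Q *v x = 0" for x
  proof (rule ccontr)
    assume "x \<noteq> 0"
    let ?v = "\<chi> i. complex_of_real (x $ i)"
    have "?v \<noteq> 0" using \<open>x \<noteq> 0\<close> by (auto simp: vec_eq_iff)
    moreover have "(\<chi> i j. complex_of_real (Q $ i $ j)) *v ?v = 0 *s ?v"
    proof -
      have "(\<Sum>j\<in>UNIV. Q $ i $ j * x $ j) = 0" for i
        using that by (simp add: matrix_vector_mult_def vec_eq_iff)
      then have "(\<Sum>j\<in>UNIV. complex_of_real (Q $ i $ j) * complex_of_real (x $ j)) = 0" for i
        by (metis (no_types, lifting) of_real_0 of_real_mult of_real_sum sum.cong)
      then show ?thesis by (simp add: matrix_vector_mult_def vec_eq_iff)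
    qed
    ultimately have "norm (0::complex) > 1" using assms unfolding expansive_def by blast
    then show False by simp
  qed
  then show ?thesis
    by (simp add: invertible_left_inverse matrix_left_invertible_ker)
qed

section \<open>Supertiles and inflated patches\<close>

lemma interior_tile: "interior (tile T p) = (+) (snd p) ` interior (T (fst p))"
  unfolding tile_def by (rule interior_translation)

lemma regular_interior_nonempty:
  assumes "regular_prototiles T"
  shows "interior (T i) \<noteq> {}"
  using assms unfolding regular_prototiles_def by (metis closure_empty)

lemma tile_shift: "tile T (i, v + s) = (+) v ` tile T (i, s)"
  unfolding tile_def by (auto simp: image_image add.assoc)

lemma tile_supertile:
  fixes Q :: "real ^ 'd ^ 'd"
  assumes "dissection Q T \<rho>" "(i, t) \<in> \<rho> j"
  shows "tile T (i, Q *v s + t) \<subseteq> (*v) Q ` tile T (j, s)"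
proof -
  have "tile T (i, t) \<subseteq> (*v) Q ` T j" using assms unfolding dissection_def by blast
  then have "(+) (Q *v s) ` tile T (i, t) \<subseteq> (+) (Q *v s) ` (*v) Q ` T j" by (rule image_mono)
  also have "\<dots> = (*v) Q ` tile T (j, s)"
    by (simp add: tile_def image_image matrix_vector_right_distrib)
  finally show ?thesis by (simp add: tile_shift)
qed

lemma interior_matrix_image:
  fixes Q :: "real ^ 'd ^ 'd"
  assumes "invertible Q"
  shows "interior ((*v) Q ` S) = (*v) Q ` interior S" "inj ((*v) Q)"
proof -
  show inj: "inj ((*v) Q)" using assms by (simp add: inj_matrix_vector_mult)
  show "interior ((*v) Q ` S) = (*v) Q ` interior S"
    by (rule interior_injective_linear_image) (auto simp: inj)
qed

lemma supertiles_disjoint: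
  assumes "dissection Q T \<rho>" "nonoverlapping T W" "(j, s) \<in> W" "(j', s') \<in> W" "(j, s) \<noteq> (j', s')"
    and "(i, t) \<in> \<rho> j" "(i', t') \<in> \<rho> j'"
  shows "interior (tile T (i, Q *v s + t)) \<inter> interior (tile T (i', Q *v s' + t')) = {}"
proof -
  have inv: "invertible Q" using assms(1) unfolding dissection_def by blast
  have 1: "interior (tile T (i, Q *v s + t)) \<subseteq> (*v) Q ` interior (tile T (j, s))"
    using interior_mono[OF tile_supertile[OF assms(1,6)]] by (simp add: interior_matrix_image[OF inv])
  have 2: "interior (tile T (i', Q *v s' + t')) \<subseteq> (*v) Q ` interior (tile T (j', s'))"
    using interior_mono[OF tile_supertile[OF assms(1,7)]] by (simp add: interior_matrix_image[OF inv])
  have "interior (tile T (j, s)) \<inter> interior (tile T (j', s')) = {}"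
    using assms(2-5) unfolding nonoverlapping_def pairwise_def by blast
  then have "(*v) Q ` interior (tile T (j, s)) \<inter> (*v) Q ` interior (tile T (j', s')) = {}"
    using image_Int[OF interior_matrix_image(2)[OF inv]] by (metis image_empty)
  then show ?thesis using 1 2 by blast
qed

lemma mem_shift: "(i, x) \<in> shift v W \<longleftrightarrow> (i, x - v) \<in> W"
  unfolding shift_def by force

text \<open>Non-overlap speaks of interiors only, so disjointness as sets of placed tiles needs an
  argument: a placed tile common to two supertiles would have empty interior, against
  regularity.\<close>

lemma supertiles_disjoint_patches:
  assumes "regular_prototiles T" "dissection Q T \<rho>" "nonoverlapping T W"
    and "p \<in> W" "p' \<in> W" "p \<noteq> p'"
  shows "(\<lambda>(j, s). shift (Q *v s) (\<rho> j)) p \<inter> (\<lambda>(j, s). shift (Q *v s) (\<rho> j)) p' = {}"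
proof -
  obtain j s j' s' where p: "p = (j, s)" "p' = (j', s')" by fastforce
  have False if "(i, x) \<in> shift (Q *v s) (\<rho> j)" "(i, x) \<in> shift (Q *v s') (\<rho> j')" for i x
  proof -
    define t t' where "t = x - Q *v s" and "t' = x - Q *v s'"
    with that have t: "x = Q *v s + t" "(i, t) \<in> \<rho> j" "x = Q *v s' + t'" "(i, t') \<in> \<rho> j'"
      by (auto simp: mem_shift)
    have "interior (tile T (i, Q *v s + t)) \<inter> interior (tile T (i, Q *v s' + t')) = {}"
      using supertiles_disjoint[OF assms(2,3)] assms(4-6) t p by metis
    then have "interior (tile T (i, x)) = {}" using t by simp
    then show False using regular_interior_nonempty[OF assms(1)] by (simp add: interior_tile)
  qed
  then show ?thesis using p by auto
qed

lemma mem_inflate: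
  "(i, x) \<in> inflate Q \<rho> W \<longleftrightarrow> (\<exists>j s t. (j, s) \<in> W \<and> (i, t) \<in> \<rho> j \<and> x = Q *v s + t)"
  (is "_ \<longleftrightarrow> ?R")
proof -
  have "(i, x) \<in> inflate Q \<rho> W \<longleftrightarrow> (\<exists>j s. (j, s) \<in> W \<and> (i, x - Q *v s) \<in> \<rho> j)"
    unfolding inflate_def
    by (simp add: mem_shift case_prod_unfold Bex_def)
  also have "\<dots> \<longleftrightarrow> ?R"
  proof -
    have "(i, x - Q *v s) \<in> \<rho> j \<longleftrightarrow> (\<exists>t. (i, t) \<in> \<rho> j \<and> x = Q *v s + t)" for s j
      by (auto intro: exI[of _ "x - Q *v s"])
    then show ?thesis by blast
  qed
  finally show ?thesis .
qed

lemma nonoverlapping_inflate: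
  assumes "dissection Q T \<rho>" "nonoverlapping T W"
  shows "nonoverlapping T (inflate Q \<rho> W)"
  unfolding nonoverlapping_def
proof (rule pairwiseI)
  fix p q assume "p \<in> inflate Q \<rho> W" "q \<in> inflate Q \<rho> W" "p \<noteq> q"
  have "\<exists>j s i t. (j, s) \<in> W \<and> (i, t) \<in> \<rho> j \<and> p = (i, Q *v s + t)" if "p \<in> inflate Q \<rho> W" for p
    using that mem_inflate[of "fst p" "snd p" Q \<rho> W] by (metis prod.collapse)
  from this[OF \<open>p \<in> _\<close>] this[OF \<open>q \<in> _\<close>] obtain j s i t j' s' i' t' where *:
    "(j, s) \<in> W" "(i, t) \<in> \<rho> j" "p = (i, Q *v s + t)"
    "(j', s') \<in> W" "(i', t') \<in> \<rho> j'" "q = (i', Q *v s' + t')"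
    by blast
  show "interior (tile T p) \<inter> interior (tile T q) = {}"
  proof (cases "(j, s) = (j', s')")
    case False
    then show ?thesis using supertiles_disjoint[OF assms *(1,4) False *(2,5)] * by simp
  next
    case True
    then have "(i, t) \<noteq> (i', t')" "(i', t') \<in> \<rho> j" using * \<open>p \<noteq> q\<close> by auto
    moreover have "nonoverlapping T (\<rho> j)" using assms(1) unfolding dissection_def by blast
    ultimately have "interior (tile T (i, t)) \<inter> interior (tile T (i', t')) = {}"
      using *(2) unfolding nonoverlapping_def pairwise_def by blast
    then have "(+) (Q *v s) ` interior (tile T (i, t)) \<inter> (+) (Q *v s) ` interior (tile T (i', t')) = {}"
      using image_Int[of "(+) (Q *v s)" "interior (tile T (i, t))" "interior (tile T (i', t'))"] by simp
    moreover have "p = (i, Q *v s + t)" "q = (i', Q *v s + t')" using *(3,6) True by auto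
    ultimately show ?thesis by (simp only: tile_shift interior_translation)
  qed
qed

text \<open>No tile has two parents, so a sum over an inflated patch is a double sum over parents
  and their rules. Both the cocycle relation and the decomposition of combs rest on this.\<close>

lemma sum_inflate:
  assumes "regular_prototiles T" "dissection Q T \<rho>" "nonoverlapping T W" "finite W"
  shows "(\<Sum>p\<in>inflate Q \<rho> W. \<phi> p) = (\<Sum>(j, s)\<in>W. \<Sum>(i, t)\<in>\<rho> j. \<phi> (i, Q *v s + t))"
proof -
  have "(\<Sum>p\<in>inflate Q \<rho> W. \<phi> p) = (\<Sum>q\<in>W. \<Sum>p\<in>(\<lambda>(j, s). shift (Q *v s) (\<rho> j)) q. \<phi> p)"
    unfolding inflate_def
  proof (rule sum.UNION_disjoint[OF assms(4)])
    show "\<forall>q\<in>W. finite ((\<lambda>(j, s). shift (Q *v s) (\<rho> j)) q)"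
      using assms(2) by (auto simp: dissection_def shift_def)
    show "\<forall>q\<in>W. \<forall>q'\<in>W. q \<noteq> q' \<longrightarrow> (\<lambda>(j, s). shift (Q *v s) (\<rho> j)) q \<inter> (\<lambda>(j, s). shift (Q *v s) (\<rho> j)) q' = {}"
      using supertiles_disjoint_patches[OF assms(1-3)] by blast
  qed
  also have "\<dots> = (\<Sum>(j, s)\<in>W. \<Sum>(i, t)\<in>\<rho> j. \<phi> (i, Q *v s + t))"
  proof (rule sum.cong, simp)
    fix q assume "q \<in> W"
    obtain j s where q: "q = (j, s)" by fastforce
    have "(\<Sum>p\<in>shift (Q *v s) (\<rho> j). \<phi> p) = (\<Sum>(i, t)\<in>\<rho> j. \<phi> (i, Q *v s + t))"
      unfolding shift_def
      by (subst sum.reindex) (auto simp: inj_on_def case_prod_unfold)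
    then show "(\<Sum>p\<in>(\<lambda>(j, s). shift (Q *v s) (\<rho> j)) q. \<phi> p)
        = (case q of (j, s) \<Rightarrow> \<Sum>(i, t)\<in>\<rho> j. \<phi> (i, Q *v s + t))"
      using q by simp
  qed
  finally show ?thesis .
qed

lemma inflate_inflate:
  "inflate Q \<rho> (inflate Q' \<rho>' W) = inflate (Q ** Q') (\<lambda>j. inflate Q \<rho> (\<rho>' j)) W"
proof -
  have "(i, x) \<in> inflate Q \<rho> (inflate Q' \<rho>' W)
    \<longleftrightarrow> (i, x) \<in> inflate (Q ** Q') (\<lambda>j. inflate Q \<rho> (\<rho>' j)) W" for i x
  proof -
    have *: "Q *v (Q' *v s + t) + t' = (Q ** Q') *v s + (Q *v t + t')" for s t t'
      by (simp add: matrix_vector_mul_assoc[symmetric] matrix_vector_right_distrib add.assoc)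
    show ?thesis
    proof
      assume "(i, x) \<in> inflate Q \<rho> (inflate Q' \<rho>' W)"
      then obtain l y t j s t' where "(j, s) \<in> W" "(l, t) \<in> \<rho>' j" "y = Q' *v s + t" "(i, t') \<in> \<rho> l" "x = Q *v y + t'"
        by (auto simp: mem_inflate)
      then show "(i, x) \<in> inflate (Q ** Q') (\<lambda>j. inflate Q \<rho> (\<rho>' j)) W"
        unfolding mem_inflate using * by blast
    next
      assume "(i, x) \<in> inflate (Q ** Q') (\<lambda>j. inflate Q \<rho> (\<rho>' j)) W"
      then obtain j s z l t t' where "(j, s) \<in> W" "(l, t) \<in> \<rho>' j" "(i, t') \<in> \<rho> l" "z = Q *v t + t'" "x = (Q ** Q') *v s + z"
        by (auto simp: mem_inflate)
      then show "(i, x) \<in> inflate Q \<rho> (inflate Q' \<rho>' W)"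
        unfolding mem_inflate using *[symmetric] by blast
    qed
  qed
  then show ?thesis by auto
qed

lemma dissection_compose:
  assumes "dissection Q T \<rho>" "dissection Q' T \<rho>'"
  shows "dissection (Q ** Q') T (\<lambda>j. inflate Q \<rho> (\<rho>' j))"
  unfolding dissection_def
proof (intro conjI allI)
  show "invertible (Q ** Q')" using assms unfolding dissection_def by (simp add: invertible_mult)
  fix j
  show "finite (inflate Q \<rho> (\<rho>' j))"
    using assms by (auto simp: dissection_def inflate_def shift_def case_prod_unfold)
  show "nonoverlapping T (inflate Q \<rho> (\<rho>' j))"
    using assms(2) nonoverlapping_inflate[OF assms(1)] by (simp add: dissection_def)
  have 1: "(*v) Q ` tile T (l, s) = (\<Union>p\<in>shift (Q *v s) (\<rho> l). tile T p)" for l s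
  proof -
    have "(*v) Q ` tile T (l, s) = (+) (Q *v s) ` (*v) Q ` T l"
      by (simp add: tile_def image_image matrix_vector_right_distrib)
    also have "\<dots> = (+) (Q *v s) ` (\<Union>p\<in>\<rho> l. tile T p)" using assms(1) by (simp add: dissection_def)
    also have "\<dots> = (\<Union>p\<in>shift (Q *v s) (\<rho> l). tile T p)"
      unfolding shift_def by (simp add: image_UN case_prod_unfold tile_shift)
    finally show ?thesis .
  qed
  have "(*v) (Q ** Q') ` T j = (*v) Q ` (*v) Q' ` T j"
    by (simp add: image_image matrix_vector_mul_assoc)
  also have "\<dots> = (\<Union>p\<in>\<rho>' j. (*v) Q ` tile T p)" using assms(2) by (simp add: dissection_def image_UN)
  also have "\<dots> = (\<Union>p\<in>inflate Q \<rho> (\<rho>' j). tile T p)"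
    by (simp add: inflate_def UN_UN_flatten case_prod_unfold 1[symmetric])
  finally show "(*v) (Q ** Q') ` T j = (\<Union>p\<in>inflate Q \<rho> (\<rho>' j). tile T p)" .
qed

section \<open>Fourier matrices of composed rules\<close>

lemma fourier_matrix_nth:
  fixes \<rho> :: "'n::finite \<Rightarrow> ('n, 'd::finite) patch"
  assumes "finite (\<rho> j)"
  shows "fourier_matrix Q \<rho> c k $ i $ j
    = (\<Sum>(i', s)\<in>\<rho> j. if i' = i then exp (2 * pi * \<i> * complex_of_real ((s + c i - Q *v c j) \<bullet> k)) else 0)"
proof -
  let ?\<phi> = "\<lambda>p. snd p + c (fst p) - Q *v c j"
  have "displacements Q \<rho> c i j = ?\<phi> ` (\<rho> j \<inter> {p. fst p = i})"
    unfolding displacements_def by force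
  moreover have "inj_on ?\<phi> (\<rho> j \<inter> {p. fst p = i})"
    by (auto simp: inj_on_def)
  ultimately have "fourier_matrix Q \<rho> c k $ i $ j
    = (\<Sum>p\<in>\<rho> j \<inter> {p. fst p = i}. exp (2 * pi * \<i> * complex_of_real (?\<phi> p \<bullet> k)))"
    unfolding fourier_matrix_def by (simp only: vec_lambda_beta sum.reindex o_def)
  also have "\<dots> = (\<Sum>p\<in>\<rho> j. if fst p = i then exp (2 * pi * \<i> * complex_of_real ((snd p + c (fst p) - Q *v c j) \<bullet> k)) else 0)"
    by (subst sum.inter_restrict[OF assms]) (auto intro!: sum.cong)
  also have "\<dots> = (\<Sum>(i', s)\<in>\<rho> j. if i' = i then exp (2 * pi * \<i> * complex_of_real ((s + c i - Q *v c j) \<bullet> k)) else 0)"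
    by (rule sum.cong) auto
  finally show ?thesis .
qed

text \<open>Through an intermediate tile of type \<open>l\<close>, a displacement splits into one
  inside the supertile of \<open>l\<close> plus the \<open>Q\<close>-image of the displacement of
  \<open>l\<close> itself; the terms \<open>Q *v c l\<close> cancel. In the phase, \<open>Q\<close>
  passes to \<open>k\<close> as its transpose.\<close>

lemma fourier_matrix_compose:
  fixes \<rho> :: "'n::finite \<Rightarrow> ('n, 'd::finite) patch"
  assumes "regular_prototiles T" "dissection Q T \<rho>" "dissection Q' T \<rho>'"
  shows "fourier_matrix (Q ** Q') (\<lambda>j. inflate Q \<rho> (\<rho>' j)) c k
    = fourier_matrix Q \<rho> c k ** fourier_matrix Q' \<rho>' c (transpose Q *v k)"
proof -
  define e where "e t k = exp (2 * pi * \<i> * complex_of_real (t \<bullet> k))" for t k :: "real ^ 'd"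
  have fin: "finite (\<rho> j)" "finite (\<rho>' j)" "finite (inflate Q \<rho> (\<rho>' j))" "nonoverlapping T (\<rho>' j)" for j
    using assms dissection_compose[OF assms(2,3)] unfolding dissection_def by auto
  have e_add: "e (Q *v s + t + c i - (Q ** Q') *v c j) k
     = e (t + c i - Q *v c l) k * e (s + c l - Q' *v c j) (transpose Q *v k)" for s t i j l
  proof -
    have "(Q *v s + t + c i - (Q ** Q') *v c j) \<bullet> k
      = (t + c i - Q *v c l) \<bullet> k + (Q *v (s + c l - Q' *v c j)) \<bullet> k"
      by (simp add: algebra_simps matrix_vector_mul_assoc[symmetric] matrix_vector_mult_diff_distrib inner_add_left inner_diff_left matrix_vector_right_distrib)
    also have "(Q *v (s + c l - Q' *v c j)) \<bullet> k = (s + c l - Q' *v c j) \<bullet> (transpose Q *v k)"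
      by (simp add: dot_lmul_matrix[symmetric] inner_commute)
    finally show ?thesis unfolding e_def by (simp add: ring_distribs exp_add)
  qed
  have "fourier_matrix (Q ** Q') (\<lambda>j. inflate Q \<rho> (\<rho>' j)) c k $ i $ j
    = (fourier_matrix Q \<rho> c k ** fourier_matrix Q' \<rho>' c (transpose Q *v k)) $ i $ j" for i j
  proof -
    have "fourier_matrix (Q ** Q') (\<lambda>j. inflate Q \<rho> (\<rho>' j)) c k $ i $ j
      = (\<Sum>(i', x)\<in>inflate Q \<rho> (\<rho>' j). if i' = i then e (x + c i - (Q ** Q') *v c j) k else 0)"
      unfolding e_def by (rule fourier_matrix_nth) (rule fin)
    also have "\<dots> = (\<Sum>(l, s)\<in>\<rho>' j. \<Sum>(i', t)\<in>\<rho> l. if i' = i then e (Q *v s + t + c i - (Q ** Q') *v c j) k else 0)"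
      by (subst sum_inflate[OF assms(1,2) fin(4,2)]) simp
    also have "\<dots> = (\<Sum>(l, s)\<in>\<rho>' j. (\<Sum>(i', t)\<in>\<rho> l. if i' = i then e (t + c i - Q *v c l) k else 0) * e (s + c l - Q' *v c j) (transpose Q *v k))"
      unfolding case_prod_unfold sum_distrib_right
    proof (intro sum.cong refl)
      fix q p
      show "(if fst p = i then e (Q *v snd q + snd p + c i - (Q ** Q') *v c j) k else 0)
        = (if fst p = i then e (snd p + c i - Q *v c (fst q)) k else 0) * e (snd q + c (fst q) - Q' *v c j) (transpose Q *v k)"
        using e_add[of "snd q" "snd p" i j "fst q"] by (simp only: split: if_split) simp
    qed
    also have "\<dots> = (\<Sum>(l, s)\<in>\<rho>' j. fourier_matrix Q \<rho> c k $ i $ l * e (s + c l - Q' *v c j) (transpose Q *v k))"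
      by (simp only: fourier_matrix_nth[OF fin(1)] e_def)
    also have "\<dots> = (\<Sum>(l', s)\<in>\<rho>' j. \<Sum>l\<in>UNIV. fourier_matrix Q \<rho> c k $ i $ l * (if l' = l then e (s + c l - Q' *v c j) (transpose Q *v k) else 0))"
      by (simp add: if_distrib[of "\<lambda>x. _ * x"] sum.delta cong: if_cong)
    also have "\<dots> = (\<Sum>l\<in>UNIV. fourier_matrix Q \<rho> c k $ i $ l * (\<Sum>(l', s)\<in>\<rho>' j. if l' = l then e (s + c l - Q' *v c j) (transpose Q *v k) else 0))"
      unfolding case_prod_unfold sum_distrib_left by (rule sum.swap)
    also have "\<dots> = (fourier_matrix Q \<rho> c k ** fourier_matrix Q' \<rho>' c (transpose Q *v k)) $ i $ j"
      unfolding matrix_matrix_mult_def by (simp only: fourier_matrix_nth[OF fin(2)] e_def vec_lambda_beta)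
    finally show ?thesis .
  qed
  then show ?thesis by (simp add: vec_eq_iff)
qed

primrec matrix_power :: "real ^ 'd ^ 'd \<Rightarrow> nat \<Rightarrow> real ^ 'd ^ 'd" where
  "matrix_power Q 0 = mat 1"
| "matrix_power Q (Suc n) = Q ** matrix_power Q n"

lemma det_matrix_power: "det (matrix_power Q n) = det Q ^ n"
  by (induction n) (auto simp: det_mul)

definition rule_power ::
  "real ^ 'd::finite ^ 'd \<Rightarrow> ('n \<Rightarrow> ('n, 'd) patch) \<Rightarrow> nat \<Rightarrow> 'n \<Rightarrow> ('n, 'd) patch" where
  "rule_power Q \<rho> n j = (inflate Q \<rho> ^^ n) {(j, 0)}"

lemma rule_power_Suc: "rule_power Q \<rho> (Suc n) = (\<lambda>j. inflate Q \<rho> (rule_power Q \<rho> n j))"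
  by (simp add: rule_power_def fun_eq_iff)

lemma inflate_funpow: "(inflate Q \<rho> ^^ n) W = inflate (matrix_power Q n) (rule_power Q \<rho> n) W"
proof (induction n)
  case 0
  show ?case by (auto simp: mem_inflate rule_power_def set_eq_iff)
next
  case (Suc n)
  then show ?case by (simp add: inflate_inflate rule_power_Suc)
qed

lemma dissection_power:
  assumes "dissection Q T \<rho>"
  shows "dissection (matrix_power Q n) T (rule_power Q \<rho> n)"
proof (induction n)
  case 0
  show ?case
    unfolding dissection_def matrix_power.simps
  proof (intro conjI allI)
    show "invertible (mat 1 :: real ^ 'd ^ 'd)" by (auto simp: invertible_def)
    fix j
    have "(*v) (mat 1) = (\<lambda>x :: real ^ 'd. x)" by auto
    moreover have "tile T (j, 0) = T j" by (simp add: tile_def)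
    ultimately show "(*v) (mat 1) ` T j = (\<Union>p\<in>rule_power Q \<rho> 0 j. tile T p)"
      by (simp add: rule_power_def)
    show "finite (rule_power Q \<rho> 0 j)" by (simp add: rule_power_def)
    show "nonoverlapping T (rule_power Q \<rho> 0 j)" by (simp add: rule_power_def nonoverlapping_def)
  qed
next
  case (Suc n)
  then show ?case using dissection_compose[OF assms] by (simp add: rule_power_Suc)
qed

text \<open>A bound on the cocycle at step \<open>n\<close> is thus a bound on the Fourier matrix of
  a single inflation, whose linear map has determinant \<open>det Q ^ n\<close>.\<close>

lemma fourier_matrix_power:
  fixes \<rho> :: "'n::finite \<Rightarrow> ('n, 'd::finite) patch"
  assumes "regular_prototiles T" "dissection Q T \<rho>"
  shows "fourier_matrix (matrix_power Q n) (rule_power Q \<rho> n) c k = cocycle Q (fourier_matrix Q \<rho> c) n k"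
proof (induction n arbitrary: k)
  case 0
  show ?case
    by (simp add: vec_eq_iff fourier_matrix_nth rule_power_def mat_def matrix_vector_mul_lid[unfolded mat_def])
next
  case (Suc n)
  show ?case
    using fourier_matrix_compose[OF assms dissection_power[OF assms(2)]]
    by (simp add: rule_power_Suc Suc)
qed

section \<open>Counting tiles\<close>

definition control_point :: "('n \<Rightarrow> real ^ 'd) \<Rightarrow> 'n \<times> (real ^ 'd) \<Rightarrow> real ^ 'd" where
  "control_point c p = snd p + c (fst p)"

lemma prototile_balls:
  fixes T :: "'n::finite \<Rightarrow> (real ^ 'd) set"
  assumes "regular_prototiles T"
  obtains \<delta> y a where "\<delta> > 0" "a > 0"
    "\<And>i. ball (y i) \<delta> \<subseteq> interior (T i)" "\<And>i. T i \<subseteq> ball (c i) a"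
proof -
  have "\<exists>y e. e > 0 \<and> ball y e \<subseteq> interior (T i)" for i
    using regular_interior_nonempty[OF assms, of i] open_interior[of "T i"]
    by (metis ex_in_conv openE)
  then obtain y e where e: "\<And>i. e i > (0::real)" "\<And>i. ball (y i) (e i) \<subseteq> interior (T i)"
    by metis
  have "\<exists>a. T i \<subseteq> ball (c i) a" for i
    using assms compact_imp_bounded bounded_subset_ballD unfolding regular_prototiles_def by blast
  then obtain a where a: "\<And>i. T i \<subseteq> ball (c i) (a i)" by metis
  show thesis
  proof
    show "Min (range e) > 0" using e by simp
    show "max 1 (Max (range a)) > 0" by simp
    show "ball (y i) (Min (range e)) \<subseteq> interior (T i)" for i
      using e(2)[of i] subset_ball[of "Min (range e)" "e i" "y i"] by fastforce
    have "a i \<le> max 1 (Max (range a))" for i by (simp add: le_max_iff_disj)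
    then show "T i \<subseteq> ball (c i) (max 1 (Max (range a)))" for i
      using a[of i] subset_ball by blast
  qed
qed

lemma packing_bound:
  fixes q :: "'a \<Rightarrow> real ^ 'd"
  assumes "finite P" "\<delta> > 0" "\<And>p. p \<in> P \<Longrightarrow> ball (q p) \<delta> \<subseteq> U"
    and "\<And>p p'. p \<in> P \<Longrightarrow> p' \<in> P \<Longrightarrow> p \<noteq> p' \<Longrightarrow> ball (q p) \<delta> \<inter> ball (q p') \<delta> = {}"
    and "bounded U" "U \<in> sets borel"
  shows "real (card P) * measure lborel (ball (0 :: real ^ 'd) \<delta>) \<le> measure lborel U"
proof -
  have U: "U \<in> fmeasurable lborel"
    using assms emeasure_bounded_finite[of U] by (simp add: fmeasurable_def)
  have "measure lborel (\<Union>p\<in>P. ball (q p) \<delta>) = (\<Sum>p\<in>P. measure lborel (ball (q p) \<delta>))"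
    by (rule measure_UNION') (use assms emeasure_bounded_finite[OF bounded_ball] in \<open>auto simp: pairwise_def disjnt_def fmeasurable_def\<close>)
  also have "\<dots> = real (card P) * measure lborel (ball (0 :: real ^ 'd) \<delta>)"
    using \<open>\<delta> > 0\<close> by (simp add: content_ball)
  finally have "real (card P) * measure lborel (ball (0 :: real ^ 'd) \<delta>) = measure lborel (\<Union>p\<in>P. ball (q p) \<delta>)" ..
  also have "\<dots> \<le> measure lborel U"
    by (rule measure_mono_fmeasurable) (use assms U in \<open>auto intro!: sets.finite_UN\<close>)
  finally show ?thesis .
qed

text \<open>A packing argument: every tile contains a ball of a fixed radius, these balls do not
  meet, and \<open>v\<close> is their volume. Neither \<open>v\<close> nor \<open>a\<close> depends
  on the tiling or on \<open>U\<close>, so the bound serves balls, boundary shells and linear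
  preimages of balls alike.\<close>

lemma tile_counting:
  fixes T :: "'n::finite \<Rightarrow> (real ^ 'd) set"
  assumes "regular_prototiles T"
  obtains v a where "v > 0" "a > 0"
    "\<And>W P U. nonoverlapping T W \<Longrightarrow> P \<subseteq> W \<Longrightarrow> bounded U \<Longrightarrow> U \<in> sets borel \<Longrightarrow>
       (\<And>p. p \<in> P \<Longrightarrow> ball (control_point c p) a \<subseteq> U) \<Longrightarrow>
       finite P \<and> real (card P) * v \<le> measure lborel U"
proof -
  obtain \<delta> y a where *: "\<delta> > 0" "a > 0"
    "\<And>i. ball (y i) \<delta> \<subseteq> interior (T i)" "\<And>i. T i \<subseteq> ball (c i) a"
    using prototile_balls[OF assms] by metis
  let ?v = "measure lborel (ball (0 :: real ^ 'd) \<delta>)"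
  show thesis
  proof
    show v: "?v > 0" using * by (simp add: content_ball_pos)
    show "a > 0" by fact
    fix W P U
    assume W: "nonoverlapping T W" "P \<subseteq> W" "bounded U" "U \<in> sets borel"
      and PU: "\<And>p. p \<in> P \<Longrightarrow> ball (control_point c p) a \<subseteq> U"
    define q where "q p = snd p + y (fst p)" for p
    have q: "ball (q p) \<delta> \<subseteq> interior (tile T p)" for p
    proof -
      have "ball (q p) \<delta> = (+) (snd p) ` ball (y (fst p)) \<delta>" by (simp only: q_def ball_translation)
      then show ?thesis unfolding interior_tile using *(3)[of "fst p"] by (metis image_mono)
    qed
    have "tile T p \<subseteq> ball (control_point c p) a" for p
    proof -
      have "ball (control_point c p) a = (+) (snd p) ` ball (c (fst p)) a" by (simp only: control_point_def ball_translation)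
      then show ?thesis unfolding tile_def using *(4)[of "fst p"] by (metis image_mono)
    qed
    then have qU: "ball (q p) \<delta> \<subseteq> U" if "p \<in> P" for p
      using q[of p] PU[OF that] interior_subset[of "tile T p"] by (meson order_trans)
    have disj: "ball (q p) \<delta> \<inter> ball (q p') \<delta> = {}" if "p \<in> P" "p' \<in> P" "p \<noteq> p'" for p p'
    proof -
      have "interior (tile T p) \<inter> interior (tile T p') = {}"
        using W that unfolding nonoverlapping_def pairwise_def by (meson subsetD)
      then show ?thesis using q[of p] q[of p'] by blast
    qed
    have bound: "real (card P') * ?v \<le> measure lborel U" if "finite P'" "P' \<subseteq> P" for P'
      proof (rule packing_bound[of _ _ q])
      show "ball (q p) \<delta> \<subseteq> U" if "p \<in> P'" for p
        using qU that \<open>P' \<subseteq> P\<close> by (meson subsetD)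
      show "ball (q p) \<delta> \<inter> ball (q p') \<delta> = {}" if "p \<in> P'" "p' \<in> P'" "p \<noteq> p'" for p p'
        using disj that \<open>P' \<subseteq> P\<close> by (meson subsetD)
    qed (use that * W in \<open>simp_all\<close>)
    \<comment> \<open>Local finiteness is not assumed; it follows because all finite subsets obey
      the same bound.\<close>
    have "finite P"
    proof (rule finite_if_finite_subsets_card_bdd[THEN conjunct1])
      fix P' assume "P' \<subseteq> P" "finite P'"
      then have "real (card P') \<le> measure lborel U / ?v"
        using bound v by (simp add: pos_le_divide_eq)
      then show "card P' \<le> nat \<lfloor>measure lborel U / ?v\<rfloor>"
        by (simp add: le_nat_floor)
    qed
    then show "finite P \<and> real (card P) * ?v \<le> measure lborel U" using bound by blast
  qed
qed

text \<open>
  \<open>Q (T j)\<close> contains a tile, hence a ball of fixed radius, so a vector with a short image under \<open>Q\<close> is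
  a difference of two points of \<open>T j\<close>.
\<close>

lemma dissection_inverse_bounded:
  fixes T :: "'n::finite \<Rightarrow> (real ^ 'd) set"
  assumes "regular_prototiles T"
  obtains R where "R > 0" "\<And>Q \<rho> x. dissection Q T \<rho> \<Longrightarrow> norm x \<le> R * norm (Q *v x)"
proof -
  obtain \<delta> y a where *: "\<delta> > 0" "a > 0"
    "\<And>i. ball (y i) \<delta> \<subseteq> interior (T i)" "\<And>i. T i \<subseteq> ball ((\<lambda>_. 0) i) a"
    using prototile_balls[OF assms, of "\<lambda>_. 0"] by metis
  show thesis
  proof
    \<comment> \<open>A multiple of \<open>Q *v x\<close> of length \<open>\<delta> / 2\<close> fits
      into the ball inside \<open>Q (T j)\<close>. Its preimage is a difference of two points of
      \<open>T j\<close>, hence of length at most \<open>2 * a\<close>, and the ratio of the two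
      lengths is the constant.\<close>
    show "4 * a / \<delta> > 0" using * by simp
    fix Q \<rho> and x :: "real ^ 'd"
    assume Q: "dissection Q T \<rho>"
    then have inj: "inj ((*v) Q)" using interior_matrix_image(2) unfolding dissection_def by blast
    show "norm x \<le> 4 * a / \<delta> * norm (Q *v x)"
    proof (cases "x = 0")
      case False
      then have nz: "norm (Q *v x) > 0"
        using inj by (metis injD matrix_vector_mult_0_right zero_less_norm_iff)
      define j :: 'n where "j = undefined"
      have "T j \<noteq> {}" using assms unfolding regular_prototiles_def by blast
      then have "\<rho> j \<noteq> {}" using Q unfolding dissection_def by (metis UN_empty empty_is_image)
      then obtain p where "p \<in> \<rho> j" by blast
      define z where "z = snd p + y (fst p)"
      have "ball z \<delta> = (+) (snd p) ` ball (y (fst p)) \<delta>" by (simp only: z_def ball_translation)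
      also have "\<dots> \<subseteq> tile T p"
        using *(3)[of "fst p"] interior_subset[of "T (fst p)"] unfolding tile_def by (meson image_mono order_trans)
      also have "\<dots> \<subseteq> (*v) Q ` T j" using Q \<open>p \<in> \<rho> j\<close> unfolding dissection_def by blast
      finally have ball: "ball z \<delta> \<subseteq> (*v) Q ` T j" .
      define w where "w = (\<delta> / 2 / norm (Q *v x)) *\<^sub>R (Q *v x)"
      have "norm w < \<delta>" using nz * by (simp add: w_def)
      then have "z \<in> ball z \<delta>" "z + w \<in> ball z \<delta>" using * by (auto simp: dist_norm)
      then obtain t t' where t: "t \<in> T j" "t' \<in> T j" "z = Q *v t" "z + w = Q *v t'"
        using ball by blast
      have "Q *v ((\<delta> / 2 / norm (Q *v x)) *\<^sub>R x) = Q *v (t' - t)"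
        using t(3) t(4)[symmetric]
        by (simp add: matrix_vector_mult_diff_distrib w_def matrix_vector_mult_scaleR)
      then have "(\<delta> / 2 / norm (Q *v x)) *\<^sub>R x = t' - t" using inj by (meson injD)
      then have "\<delta> / 2 / norm (Q *v x) * norm x = norm (t' - t)"
        using * nz by (metis abs_of_pos divide_pos_pos half_gt_zero norm_scaleR)
      also have "\<dots> \<le> 2 * a"
        
      proof -
        have "norm t < a" "norm t' < a" using *(4)[of j] t by auto
        then show ?thesis using norm_triangle_ineq4[of t' t] by linarith
      qed
      finally show ?thesis using nz * by (simp add: field_simps)
    qed simp
  qed
qed

text \<open>The source of the factor 1 / |det Q|: up to a bounded margin, the parents of the tiles
  in a ball have their control points in such a preimage.\<close>

lemma measure_matrix_preimage_ball:
  fixes Q :: "real ^ 'd ^ 'd"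
  assumes "invertible Q"
  shows "measure lborel {x. norm (Q *v x) < r} = measure lborel (ball (0 :: real ^ 'd) r) / \<bar>det Q\<bar>"
    "bounded {x. norm (Q *v x) < r}" "{x. norm (Q *v x) < r} \<in> sets borel"
proof -
  let ?U = "{x. norm (Q *v x) < r}"
  obtain Q' where Q': "Q' ** Q = mat 1" "Q ** Q' = mat 1" using assms unfolding invertible_def by auto
  have eq: "(*v) Q' ` ball 0 r = ?U"
  proof -
    have "Q' *v (Q *v x) = x" "Q *v (Q' *v x) = x" for x
      by (simp_all add: matrix_vector_mul_assoc Q')
    then show ?thesis by (auto intro!: image_eqI[of _ "(*v) Q'" "Q *v _"])
  qed
  have "bounded ((*v) Q' ` ball 0 r)" by (intro bounded_linear_image) (auto simp: matrix_vector_mul_bounded_linear)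
  then show "bounded ?U" using eq by simp
  have "open ?U" by (intro open_Collect_less continuous_intros)
  then show U: "?U \<in> sets borel" by simp
  have "measure lebesgue ((*v) Q' ` ball 0 r) = \<bar>det Q'\<bar> * measure lebesgue (ball (0 :: real ^ 'd) r)"
    by (intro measure_matrix_image[THEN conjunct2] lmeasurable_ball)
  also have "det Q' = 1 / det Q"
  proof -
    have "det Q' * det Q = 1" using Q'(1) by (metis det_I det_mul)
    then show ?thesis by (metis mult_zero_right nonzero_eq_divide_eq zero_neq_one)
  qed
  finally show "measure lborel ?U = measure lborel (ball (0 :: real ^ 'd) r) / \<bar>det Q\<bar>"
    using U by (simp add: eq measure_completion)
qed

text \<open>Enlarging a ball by a fixed margin does not change its volume asymptotically, so
  boundary layers of fixed width disappear from averages.\<close>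

lemma ball_volume_ratio:
  fixes b :: real
  shows "((\<lambda>r. measure lborel (ball (0 :: real ^ 'd) (r + b)) / measure lborel (ball (0 :: real ^ 'd) r)) \<longlongrightarrow> 1) at_top"
proof -
  have "((\<lambda>r. 1 + b * inverse r) \<longlongrightarrow> 1 + b * 0) at_top"
    by (intro tendsto_intros tendsto_inverse_0_at_top filterlim_ident)
  then have "((\<lambda>r. (1 + b * inverse r) ^ CARD('d)) \<longlongrightarrow> (1 + b * 0) ^ CARD('d)) at_top"
    by (rule tendsto_power)
  then have lim: "((\<lambda>r. (1 + b * inverse r) ^ CARD('d)) \<longlongrightarrow> 1) at_top" by simp
  \<comment> \<open>Both radii are then positive, as the volume formula and the quotient
    require.\<close>
  have "eventually (\<lambda>r. r > max 0 (- b)) at_top" by (rule eventually_gt_at_top)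
  then have "eventually (\<lambda>r. (1 + b * inverse r) ^ CARD('d)
     = measure lborel (ball (0 :: real ^ 'd) (r + b)) / measure lborel (ball (0 :: real ^ 'd) r)) at_top"
  proof eventually_elim
    case (elim r)
    then have "1 + b * inverse r = (r + b) / r" by (simp add: field_simps)
    with elim show ?case by (simp add: content_ball power_divide unit_ball_vol_pos[THEN less_imp_neq, THEN not_sym])
  qed
  then show ?thesis using lim by (rule Lim_transform_eventually[rotated])
qed

section \<open>Test functions and damping\<close>

lemma Cc_iff: "Cc f \<longleftrightarrow> continuous_on UNIV f \<and> (\<exists>R. \<forall>z. norm z > R \<longrightarrow> f z = 0)"
proof -
  have "bounded {x. f x \<noteq> 0} \<longleftrightarrow> (\<exists>R. \<forall>z. norm z > R \<longrightarrow> f z = 0)"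
    unfolding bounded_iff mem_Collect_eq Ball_def by (meson linorder_not_le)
  then show ?thesis unfolding Cc_def by (simp add: compact_closure)
qed

lemma Cc_continuous: "Cc f \<Longrightarrow> continuous_on UNIV f"
  by (simp add: Cc_iff)

lemma Cc_support:
  assumes "Cc f"
  obtains R where "R > 0" "\<And>z. norm z > R \<Longrightarrow> f z = 0"
proof -
  obtain R where R: "\<And>z. norm z > R \<Longrightarrow> f z = 0" using assms unfolding Cc_iff by blast
  show thesis by (rule that[of "max R 1"]) (auto intro: R)
qed

lemma integrable_continuous_bounded_support:
  fixes f :: "real ^ 'd \<Rightarrow> 'b :: {banach, second_countable_topology}"
  assumes "continuous_on UNIV f" "\<And>z. norm z > R \<Longrightarrow> f z = 0"
  shows "integrable lborel f"
proof -
  have "integrable lborel (\<lambda>z. indicator (cball 0 R) z *\<^sub>R f z)"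
    by (rule borel_integrable_compact) (auto intro: continuous_on_subset[OF assms(1)])
  moreover have "(\<lambda>z. indicator (cball 0 R) z *\<^sub>R f z) = f"
    using assms(2) by (force simp: indicator_def)
  ultimately show ?thesis by simp
qed

lemma Cc_integrable: "Cc f \<Longrightarrow> integrable lborel f"
  using integrable_continuous_bounded_support unfolding Cc_iff by blast

lemma Cc_shift:
  assumes "Cc f"
  shows "Cc (\<lambda>z. f (z + t))"
proof -
  obtain R where R: "\<And>z. norm z > R \<Longrightarrow> f z = 0" using Cc_support[OF assms] by metis
  have "f (z + t) = 0" if "norm z > R + norm t" for z
  proof (rule R)
    have "norm z \<le> norm (z + t) + norm t" using norm_triangle_ineq4[of "z + t" t] by simp
    with that show "norm (z + t) > R" by linarith
  qed
  moreover have "continuous_on UNIV (\<lambda>z. f (z + t))"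
    by (rule continuous_on_compose2[OF Cc_continuous[OF assms]]) (auto intro!: continuous_intros)
  ultimately show ?thesis unfolding Cc_iff by blast
qed

lemma Cc_mult_left:
  assumes "Cc f" "continuous_on UNIV g"
  shows "Cc (\<lambda>z. g z * f z)"
  using assms unfolding Cc_iff by (auto intro!: continuous_on_mult)

lemma Cc_scale: "Cc f \<Longrightarrow> Cc (\<lambda>z. a * f z)"
  by (rule Cc_mult_left) auto

lemma Cc_add:
  assumes "Cc f" "Cc g"
  shows "Cc (\<lambda>z. f z + g z)"
proof -
  obtain R R' where "\<And>z. norm z > R \<Longrightarrow> f z = 0" "\<And>z. norm z > R' \<Longrightarrow> g z = 0"
    using assms Cc_support by metis
  then have "\<forall>z. norm z > max R R' \<longrightarrow> f z + g z = 0" by simp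
  moreover have "continuous_on UNIV (\<lambda>z. f z + g z)"
    using assms Cc_continuous by (intro continuous_on_add) auto
  ultimately show ?thesis unfolding Cc_iff by blast
qed

lemma Cc_zero: "Cc (\<lambda>_. 0)"
  unfolding Cc_iff by auto

lemma Cc_diff: "Cc f \<Longrightarrow> Cc g \<Longrightarrow> Cc (\<lambda>z. f z - g z)"
  using Cc_add[of f "\<lambda>z. (- 1) * g z"] Cc_scale[of g "- 1"] by simp

lemma Cc_sum: "(\<And>p. p \<in> P \<Longrightarrow> Cc (F p)) \<Longrightarrow> Cc (\<lambda>z. \<Sum>p\<in>P. F p z)"
  by (induction P rule: infinite_finite_induct) (auto simp: Cc_zero Cc_add)

lemmas Cc_intros = Cc_shift Cc_scale Cc_add Cc_diff Cc_sum

lemma Cc_mult_cnj: "Cc f \<Longrightarrow> Cc g \<Longrightarrow> Cc (\<lambda>z. f z * cnj (g z))"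
  using Cc_mult_left[of f "\<lambda>z. cnj (g z)"] Cc_continuous[of g]
  by (simp add: mult.commute continuous_on_cnj)

lemma Cc_square_integrable:
  assumes "Cc f"
  shows "integrable lborel (\<lambda>z. (norm (f z))\<^sup>2)"
proof -
  obtain R where R: "\<And>z. norm z > R \<Longrightarrow> f z = 0" using Cc_support[OF assms] by metis
  show ?thesis
    by (rule integrable_continuous_bounded_support[of _ R])
      (auto intro!: continuous_intros Cc_continuous[OF assms] simp: R)
qed

lemma lborel_integral_shift:
  fixes f :: "'a :: euclidean_space \<Rightarrow> 'b :: {banach, second_countable_topology}"
  assumes "f \<in> borel_measurable borel"
  shows "(\<integral>z. f (z + t) \<partial>lborel) = (\<integral>z. f z \<partial>lborel)"
proof -
  have "(\<integral>z. f z \<partial>lborel) = (\<integral>z. f z \<partial>distr lborel borel ((+) t))"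
    by (simp add: lborel_distr_plus)
  also have "\<dots> = (\<integral>z. f (t + z) \<partial>lborel)"
    by (rule integral_distr) (use assms in auto)
  finally show ?thesis by (simp add: add.commute)
qed

lemma Cc_integral_shift: "Cc f \<Longrightarrow> (\<integral>z. f (z + t) \<partial>lborel) = (\<integral>z. f z \<partial>lborel)"
  by (rule lborel_integral_shift) (simp add: Cc_continuous borel_measurable_continuous_onI)

section \<open>Inner products and square integrals of test functions\<close>

definition L2_inner :: "(real ^ 'd \<Rightarrow> complex) \<Rightarrow> (real ^ 'd \<Rightarrow> complex) \<Rightarrow> complex" where
  "L2_inner f g = (\<integral>z. f z * cnj (g z) \<partial>lborel)"

definition L2_sq :: "(real ^ 'd \<Rightarrow> complex) \<Rightarrow> real" where
  "L2_sq f = (\<integral>z. (norm (f z))\<^sup>2 \<partial>lborel)"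

lemma L2_sq_nonneg: "L2_sq f \<ge> 0"
  unfolding L2_sq_def by simp

lemma L2_inner_self: "L2_inner f f = complex_of_real (L2_sq f)"
  unfolding L2_inner_def L2_sq_def
  by (simp add: complex_norm_square[symmetric] flip: integral_complex_of_real of_real_power)

lemma L2_inner_commute: "L2_inner g f = cnj (L2_inner f g)"
  unfolding L2_inner_def by (subst Bochner_Integration.integral_cnj[symmetric]) (simp add: mult.commute)

lemma L2_inner_diff:
  assumes "Cc f" "Cc g" "Cc h"
  shows "L2_inner (\<lambda>z. f z - g z) h = L2_inner f h - L2_inner g h"
    and "L2_inner h (\<lambda>z. f z - g z) = L2_inner h f - L2_inner h g"
  by (simp_all add: L2_inner_def left_diff_distrib right_diff_distrib
      Bochner_Integration.integral_diff Cc_integrable Cc_mult_cnj assms)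

lemma L2_sq_shift: "Cc f \<Longrightarrow> L2_sq (\<lambda>z. f (z + t)) = L2_sq f"
  unfolding L2_sq_def
  by (rule lborel_integral_shift)
    (auto intro!: borel_measurable_continuous_onI continuous_intros Cc_continuous)

lemma L2_sq_mono:
  assumes "Cc f" "integrable lborel g" "\<And>z. (norm (f z))\<^sup>2 \<le> g z"
  shows "L2_sq f \<le> (\<integral>z. g z \<partial>lborel)"
  unfolding L2_sq_def by (intro integral_mono Cc_square_integrable assms)

lemma norm_sum_weighted_le:
  fixes u :: "'a \<Rightarrow> complex"
  assumes "finite A"
  shows "(norm (\<Sum>i\<in>A. u i * v i))\<^sup>2 \<le> (\<Sum>i\<in>A. (norm (u i))\<^sup>2) * (\<Sum>i\<in>A. (norm (v i))\<^sup>2)"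
proof -
  have "norm (\<Sum>i\<in>A. u i * v i) \<le> (\<Sum>i\<in>A. norm (u i) * norm (v i))"
    by (metis (mono_tags, lifting) norm_mult norm_sum sum.cong)
  then have "(norm (\<Sum>i\<in>A. u i * v i))\<^sup>2 \<le> (\<Sum>i\<in>A. norm (u i) * norm (v i))\<^sup>2"
    by (intro power_mono) auto
  also have "\<dots> \<le> (\<Sum>i\<in>A. (norm (u i))\<^sup>2) * (\<Sum>i\<in>A. (norm (v i))\<^sup>2)"
    by (rule Cauchy_Schwarz_ineq_sum)
  finally show ?thesis .
qed

lemma L2_sq_sum_weighted_le:
  assumes "finite A" "\<And>i. i \<in> A \<Longrightarrow> Cc (F i)"
  shows "L2_sq (\<lambda>z. \<Sum>i\<in>A. u i * F i z) \<le> (\<Sum>i\<in>A. (norm (u i))\<^sup>2) * (\<Sum>i\<in>A. L2_sq (F i))"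
proof -
  have "L2_sq (\<lambda>z. \<Sum>i\<in>A. u i * F i z) \<le> (\<integral>z. (\<Sum>i\<in>A. (norm (u i))\<^sup>2) * (\<Sum>i\<in>A. (norm (F i z))\<^sup>2) \<partial>lborel)"
    by (intro L2_sq_mono norm_sum_weighted_le integrable_mult_right Bochner_Integration.integrable_sum
        Cc_square_integrable Cc_intros assms)
  also have "\<dots> = (\<Sum>i\<in>A. (norm (u i))\<^sup>2) * (\<Sum>i\<in>A. L2_sq (F i))"
    unfolding L2_sq_def by (simp add: Bochner_Integration.integral_sum Cc_square_integrable assms)
  finally show ?thesis .
qed

lemma L2_sq_add_le:
  assumes "Cc f" "Cc g"
  shows "L2_sq (\<lambda>z. f z + g z) \<le> 2 * L2_sq f + 2 * L2_sq g"
proof -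
  \<comment> \<open>The two summands are indexed by \<open>bool\<close>, so the constant 2 is the
    number of summands in the Cauchy-Schwarz bound.\<close>
  have "L2_sq (\<lambda>z. \<Sum>b\<in>UNIV. 1 * (if b then f else g) z) \<le> (\<Sum>b\<in>(UNIV :: bool set). (norm (1 :: complex))\<^sup>2) * (\<Sum>b\<in>UNIV. L2_sq (if b then f else g))"
    by (rule L2_sq_sum_weighted_le) (use assms in auto)
  then show ?thesis by (simp add: UNIV_bool add.commute)
qed

text \<open>At every point at most \<open>K\<close> of the translates of \<open>f\<close> are nonzero.\<close>

lemma L2_sq_bounded_overlap:
  fixes x :: "'p \<Rightarrow> real ^ 'd"
  assumes "finite P" "Cc f" "\<And>z. norm z > R \<Longrightarrow> f z = 0"
    and K: "\<And>p. p \<in> P \<Longrightarrow> real (card {p' \<in> P. norm (x p' - x p) \<le> 2 * R}) \<le> K"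
    and "K \<ge> 0" "\<And>p. p \<in> P \<Longrightarrow> norm (w p) \<le> \<omega>"
  shows "L2_sq (\<lambda>z. \<Sum>p\<in>P. w p * f (z + x p)) \<le> \<omega>\<^sup>2 * K * real (card P) * L2_sq f"
proof -
  have pointwise: "(norm (\<Sum>p\<in>P. w p * f (z + x p)))\<^sup>2 \<le> (\<Sum>p\<in>P. \<omega>\<^sup>2 * K * (norm (f (z + x p)))\<^sup>2)" for z
  proof -
    define A where "A = {p \<in> P. f (z + x p) \<noteq> 0}"
    have A: "finite A" "A \<subseteq> P" using assms(1) unfolding A_def by auto
    have cardA: "real (card A) \<le> K"
    proof (cases "A = {}")
      case False
      then obtain p where p: "p \<in> A" by blast
      \<comment> \<open>Translates that are both nonzero at \<open>z\<close> have base points at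
        most \<open>2 * R\<close> apart, so a single member of \<open>A\<close> has all the others
        in its neighbourhood.\<close>
      have "A \<subseteq> {p' \<in> P. norm (x p' - x p) \<le> 2 * R}"
      proof
        fix p' assume "p' \<in> A"
        then have "norm (z + x p') \<le> R" "norm (z + x p) \<le> R"
          using p assms(3) unfolding A_def by (force simp: not_less[symmetric])+
        then have "norm ((z + x p') - (z + x p)) \<le> 2 * R"
          using norm_triangle_ineq4[of "z + x p'" "z + x p"] by linarith
        then show "p' \<in> {p' \<in> P. norm (x p' - x p) \<le> 2 * R}" using \<open>p' \<in> A\<close> A by auto
      qed
      then have "card A \<le> card {p' \<in> P. norm (x p' - x p) \<le> 2 * R}"
        using assms(1) by (intro card_mono) auto
      then show ?thesis using K[of p] p A by auto
    qed (use \<open>K \<ge> 0\<close> in simp)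
    have "(norm (\<Sum>p\<in>P. w p * f (z + x p)))\<^sup>2 = (norm (\<Sum>p\<in>A. w p * f (z + x p)))\<^sup>2"
      using assms(1) unfolding A_def by (intro arg_cong[where f = "\<lambda>s. (norm s)\<^sup>2"] sum.mono_neutral_right) auto
    also have "\<dots> \<le> (\<Sum>p\<in>A. (norm (w p))\<^sup>2) * (\<Sum>p\<in>A. (norm (f (z + x p)))\<^sup>2)"
      by (rule norm_sum_weighted_le) fact
    also have "(\<Sum>p\<in>A. (norm (w p))\<^sup>2) \<le> (\<Sum>p\<in>A. \<omega>\<^sup>2)"
      using assms(6) A by (intro sum_mono power_mono) auto
    also have "\<dots> \<le> \<omega>\<^sup>2 * K" using cardA by (simp add: mult.commute[of _ "\<omega>\<^sup>2"] mult_left_mono)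
    also have "(\<Sum>p\<in>A. (norm (f (z + x p)))\<^sup>2) \<le> (\<Sum>p\<in>P. (norm (f (z + x p)))\<^sup>2)"
      using A assms(1) by (intro sum_mono2) auto
    finally show ?thesis using \<open>K \<ge> 0\<close>
      by (simp add: sum_distrib_left[symmetric] mult_left_mono mult_right_mono sum_nonneg)
  qed
  have "L2_sq (\<lambda>z. \<Sum>p\<in>P. w p * f (z + x p)) \<le> (\<integral>z. (\<Sum>p\<in>P. \<omega>\<^sup>2 * K * (norm (f (z + x p)))\<^sup>2) \<partial>lborel)"
    by (intro L2_sq_mono pointwise integrable_mult_right Bochner_Integration.integrable_sum
        Cc_square_integrable Cc_intros assms)
  also have "\<dots> = (\<Sum>p\<in>P. \<omega>\<^sup>2 * K * L2_sq (\<lambda>z. f (z + x p)))"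
    unfolding L2_sq_def
    by (subst Bochner_Integration.integral_sum) (auto intro!: integrable_mult_right Cc_square_integrable Cc_intros assms)
  also have "\<dots> = \<omega>\<^sup>2 * K * real (card P) * L2_sq f"
    by (simp add: L2_sq_shift assms)
  finally show ?thesis .
qed

section \<open>The damping operator\<close>

definition translate_sum :: "(real ^ 'd) set \<Rightarrow> (real ^ 'd \<Rightarrow> complex) \<Rightarrow> real ^ 'd \<Rightarrow> complex" where
  "translate_sum D f z = (\<Sum>t\<in>D. f (z + t))"

text \<open>Each exponential sum over \<open>D k\<close> has modulus at most
  \<open>card (D k)\<close>, so this bounds the sum of their squared moduli at every frequency. It
  is the normalisation that keeps the damping factor in the unit interval.\<close>

definition square_card_sum :: "'k set \<Rightarrow> ('k \<Rightarrow> (real ^ 'd) set) \<Rightarrow> real" where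
  "square_card_sum I D = (\<Sum>k\<in>I. (real (card (D k)))\<^sup>2)"

text \<open>
  With \<open>B\<^sub>k\<close> for \<open>translate_sum (D k)\<close> this is \<open>1 - (\<Sum>k. B\<^sub>k\<^sup>* B\<^sub>k) / M\<close>, a self-adjoint operator
  between \<open>0\<close> and \<open>1\<close>.
\<close>

definition damping :: "'k set \<Rightarrow> ('k \<Rightarrow> (real ^ 'd) set) \<Rightarrow> (real ^ 'd \<Rightarrow> complex) \<Rightarrow> real ^ 'd \<Rightarrow> complex" where
  "damping I D f z = f z - complex_of_real (1 / square_card_sum I D) *
     (\<Sum>k\<in>I. \<Sum>s\<in>D k. \<Sum>t\<in>D k. f (z + (s - t)))"

lemma Cc_translate_sum: "Cc f \<Longrightarrow> Cc (translate_sum D f)"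
  unfolding translate_sum_def by (intro Cc_intros)

lemma Cc_damping: "Cc f \<Longrightarrow> Cc (damping I D f)"
  unfolding damping_def by (intro Cc_intros)

lemma Cc_damping_funpow: "Cc f \<Longrightarrow> Cc ((damping I D ^^ n) f)"
  by (induction n) (auto simp: Cc_damping)

lemma L2_sq_translate_sum_le:
  assumes "Cc f"
  shows "L2_sq (translate_sum D f) \<le> (real (card D))\<^sup>2 * L2_sq f"
proof (cases "finite D")
  case True
  have "L2_sq (\<lambda>z. \<Sum>t\<in>D. 1 * f (z + t)) \<le> (\<Sum>t\<in>D. (norm (1 :: complex))\<^sup>2) * (\<Sum>t\<in>D. L2_sq (\<lambda>z. f (z + t)))"
    by (intro L2_sq_sum_weighted_le True Cc_intros assms)
  then show ?thesis
    unfolding translate_sum_def by (simp add: L2_sq_shift assms power2_eq_square mult.assoc)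
qed (simp add: translate_sum_def L2_sq_def)

text \<open>Translation invariance puts both shifts on \<open>f\<close>. The adjoint of
  \<open>translate_sum D\<close> times itself is therefore the sum over differences that occurs in
  \<open>damping\<close>.\<close>

lemma L2_inner_translate_sum:
  assumes "Cc f" "Cc g"
  shows "L2_inner (translate_sum D f) (translate_sum D g) = (\<Sum>s\<in>D. \<Sum>t\<in>D. L2_inner (\<lambda>z. f (z + (s - t))) g)"
proof -
  have shift: "L2_inner (\<lambda>z. f (z + s)) (\<lambda>z. g (z + t)) = L2_inner (\<lambda>z. f (z + (s - t))) g" for s t
    using Cc_integral_shift[of "\<lambda>z. f (z + (s - t)) * cnj (g z)" t]
    by (simp add: L2_inner_def Cc_mult_cnj Cc_intros assms add.assoc)
  have "L2_inner (translate_sum D f) (translate_sum D g)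
      = (\<integral>z. (\<Sum>s\<in>D. \<Sum>t\<in>D. f (z + s) * cnj (g (z + t))) \<partial>lborel)"
    unfolding L2_inner_def translate_sum_def by (simp add: sum_product)
  also have "\<dots> = (\<Sum>s\<in>D. \<Sum>t\<in>D. L2_inner (\<lambda>z. f (z + s)) (\<lambda>z. g (z + t)))"
    unfolding L2_inner_def
    by (simp add: Bochner_Integration.integral_sum Bochner_Integration.integrable_sum
        Cc_integrable Cc_mult_cnj Cc_intros assms)
  finally show ?thesis by (simp add: shift)
qed

lemma L2_inner_damping:
  assumes "Cc f" "Cc g"
  shows "L2_inner (damping I D f) g = L2_inner f g - complex_of_real (1 / square_card_sum I D) *
    (\<Sum>k\<in>I. L2_inner (translate_sum (D k) f) (translate_sum (D k) g))"
proof -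
  let ?F = "\<lambda>z. \<Sum>k\<in>I. \<Sum>s\<in>D k. \<Sum>t\<in>D k. f (z + (s - t))"
  let ?\<kappa> = "complex_of_real (1 / square_card_sum I D)"
  have "L2_inner (damping I D f) g = L2_inner f g - L2_inner (\<lambda>z. ?\<kappa> * ?F z) g"
    unfolding damping_def by (intro L2_inner_diff Cc_intros assms)
  also have "L2_inner (\<lambda>z. ?\<kappa> * ?F z) g = ?\<kappa> * L2_inner ?F g"
    unfolding L2_inner_def by (simp add: mult.assoc)
  also have "L2_inner ?F g = (\<Sum>k\<in>I. \<Sum>s\<in>D k. \<Sum>t\<in>D k. L2_inner (\<lambda>z. f (z + (s - t))) g)"
    unfolding L2_inner_def
    by (simp add: sum_distrib_right Bochner_Integration.integral_sum Bochner_Integration.integrable_sum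
        Cc_integrable Cc_mult_cnj Cc_intros assms)
  finally show ?thesis by (simp add: L2_inner_translate_sum assms)
qed

lemma L2_inner_damping_commute:
  assumes "Cc f" "Cc g"
  shows "L2_inner (damping I D f) g = L2_inner f (damping I D g)"
proof -
  have "L2_inner f (damping I D g) = cnj (L2_inner (damping I D g) f)" by (rule L2_inner_commute)
  also have "\<dots> = L2_inner (damping I D f) g"
    unfolding L2_inner_damping[OF assms] L2_inner_damping[OF assms(2,1)]
    by (simp add: L2_inner_commute[symmetric])
  finally show ?thesis ..
qed

lemma L2_inner_damping_self:
  assumes "Cc f"
  shows "Re (L2_inner (damping I D f) f) = L2_sq f - 1 / square_card_sum I D * (\<Sum>k\<in>I. L2_sq (translate_sum (D k) f))"
  by (simp add: L2_inner_damping assms L2_inner_self flip: of_real_sum)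

lemma L2_inner_damping_nonneg:
  assumes "Cc f"
  shows "Re (L2_inner (damping I D f) f) \<ge> 0"
proof -
  have M: "square_card_sum I D \<ge> 0" unfolding square_card_sum_def by (simp add: sum_nonneg)
  have "(\<Sum>k\<in>I. L2_sq (translate_sum (D k) f)) \<le> square_card_sum I D * L2_sq f"
    unfolding square_card_sum_def sum_distrib_right by (intro sum_mono L2_sq_translate_sum_le assms)
  \<comment> \<open>If the normalisation is 0, then \<open>1 / 0 = 0\<close> makes the subtracted
    term vanish.\<close>
  then have "1 / square_card_sum I D * (\<Sum>k\<in>I. L2_sq (translate_sum (D k) f)) \<le> L2_sq f"
    using M L2_sq_nonneg[of f] by (cases "square_card_sum I D = 0") (auto simp: field_simps)
  then show ?thesis by (simp add: L2_inner_damping_self assms)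
qed

lemma damping_diff: "damping I D (\<lambda>z. f z - g z) = (\<lambda>z. damping I D f z - damping I D g z)"
  by (rule ext) (simp add: damping_def sum_subtractf algebra_simps)

text \<open>The differences do not increase, so the last one is at most the average of all
  \<open>Suc n\<close>, and their sum telescopes to at most \<open>q 0\<close>. For the moments of a
  number Y = 1 - x in the unit interval this is the inequality x (1 - x)^n <= 1 / (n + 1).\<close>

lemma convex_seq_last_difference:
  fixes q :: "nat \<Rightarrow> real"
  assumes "\<And>i. q i \<ge> 0" "\<And>i. q (Suc i) - q (Suc (Suc i)) \<le> q i - q (Suc i)"
  shows "real (Suc n) * (q n - q (Suc n)) \<le> q 0"
proof -
  have "q n - q (Suc n) \<le> q i - q (Suc i)" if "i \<le> n" for i
    using that by (induction rule: inc_induct) (use assms(2) order_trans in blast)+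
  then have "(\<Sum>i\<le>n. q n - q (Suc n)) \<le> (\<Sum>i\<le>n. q i - q (Suc i))" by (intro sum_mono) auto
  also have "\<dots> = q 0 - q (Suc n)" by (rule sum_telescope)
  finally show ?thesis using assms(1)[of "Suc n"] by simp
qed

text \<open>
  The moments \<open>\<langle>Y\<^sup>m f, f\<rangle>\<close> of a self-adjoint operator \<open>0 \<le> Y \<le> 1\<close> are nonnegative and convex in \<open>m\<close>;
  the left-hand side is \<open>M (\<langle>Y\<^sup>2\<^sup>N f, f\<rangle> - \<langle>Y\<^sup>2\<^sup>N\<^sup>+\<^sup>1 f, f\<rangle>)\<close>.
\<close>

lemma damping_power_bound:
  assumes f: "Cc f" and M: "square_card_sum I D > 0"
  shows "(\<Sum>k\<in>I. L2_sq (translate_sum (D k) ((damping I D ^^ N) f)))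
     \<le> square_card_sum I D / real (2 * N + 1) * L2_sq f"
proof -
  let ?Y = "damping I D"
  define q where "q m = Re (L2_inner ((?Y ^^ m) f) f)" for m
  have Cc: "Cc ((?Y ^^ m) f)" for m by (rule Cc_damping_funpow[OF f])
  have inner: "L2_inner ((?Y ^^ i) f) ((?Y ^^ j) f) = L2_inner ((?Y ^^ (i + j)) f) f" for i j
  proof (induction j arbitrary: i)
    case (Suc j)
    have "L2_inner ((?Y ^^ i) f) ((?Y ^^ Suc j) f) = L2_inner ((?Y ^^ Suc i) f) ((?Y ^^ j) f)"
      by (simp add: L2_inner_damping_commute[OF Cc Cc])
    then show ?case using Suc[of "Suc i"] by simp
  qed simp
  have q_sum: "Re (L2_inner ((?Y ^^ i) f) ((?Y ^^ j) f)) = q (i + j)" for i j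
    unfolding q_def inner ..
  \<comment> \<open>By self-adjointness an even moment is a square integral of Y^i f, and an odd one
    is the form of Y at Y^i f; both are nonnegative.\<close>
  have even_odd: "\<exists>i. m = i + i \<or> m = Suc i + i" for m :: nat
    by (metis add_Suc evenE mult_2 oddE Suc_eq_plus1)
  have nonneg: "q m \<ge> 0" for m
  proof -
    obtain i where "m = i + i \<or> m = Suc i + i" using even_odd by blast
    then show ?thesis
      using q_sum[of i i] q_sum[of "Suc i" i] L2_inner_damping_nonneg[OF Cc[of i], of I D]
        L2_sq_nonneg[of "(?Y ^^ i) f"]
      by (auto simp: L2_inner_self L2_sq_nonneg)
  qed
  have convex: "q (Suc m) - q (Suc (Suc m)) \<le> q m - q (Suc m)" for m
  proof -
    obtain i where i: "m = i + i \<or> m = Suc i + i" using even_odd by blast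
    \<comment> \<open>The second difference of the moments is again of one of the two kinds: the
      square integral of \<open>w\<close> at even index, the form of Y at \<open>w\<close> at odd
      index.\<close>
    define w where "w = (\<lambda>z. (?Y ^^ i) f z - (?Y ^^ Suc i) f z)"
    have w: "Cc w" unfolding w_def by (intro Cc_diff Cc)
    have "Re (L2_inner w w) = q (i + i) - q (Suc i + i) - (q (i + Suc i) - q (Suc i + Suc i))"
      unfolding w_def L2_inner_diff[OF Cc Cc Cc_diff[OF Cc Cc]] L2_inner_diff[OF Cc Cc Cc] minus_complex.sel q_sum
      by simp
    then have 1: "q (i + i) - 2 * q (Suc (i + i)) + q (Suc (Suc (i + i))) \<ge> 0"
      using L2_sq_nonneg[of w] by (simp add: L2_inner_self)
    have Yw: "?Y w = (\<lambda>z. (?Y ^^ Suc i) f z - (?Y ^^ Suc (Suc i)) f z)"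
      unfolding w_def damping_diff by simp
    have "Re (L2_inner (?Y w) w) = q (Suc i + i) - q (Suc (Suc i) + i) - (q (Suc i + Suc i) - q (Suc (Suc i) + Suc i))"
      unfolding Yw unfolding w_def L2_inner_diff[OF Cc Cc Cc_diff[OF Cc Cc]] L2_inner_diff[OF Cc Cc Cc] minus_complex.sel q_sum
      by simp
    then have 2: "q (Suc (i + i)) - 2 * q (Suc (Suc (i + i))) + q (Suc (Suc (Suc (i + i)))) \<ge> 0"
      using L2_inner_damping_nonneg[OF w, of I D] by simp
    from i show ?thesis using 1 2 by auto
  qed
  let ?d = "q (2 * N) - q (Suc (2 * N))" and ?S = "\<Sum>k\<in>I. L2_sq (translate_sum (D k) ((?Y ^^ N) f))"
  \<comment> \<open>The normalised sum is the form of 1 - Y at Y^N f, that is, a difference of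
    consecutive moments.\<close>
  have "1 / square_card_sum I D * ?S = q (2 * N) - q (Suc (2 * N))"
    using L2_inner_damping_self[OF Cc[of N], of I D] q_sum[of N N] q_sum[of "Suc N" N]
    by (simp add: L2_inner_self mult_2)
  then have S: "?S = square_card_sum I D * ?d" using M by (simp add: field_simps)
  have "real (Suc (2 * N)) * ?d \<le> q 0"
    by (rule convex_seq_last_difference) (fact nonneg convex)+
  then have "?d \<le> q 0 / real (2 * N + 1)" by (simp add: pos_le_divide_eq mult.commute)
  then have "?S \<le> square_card_sum I D * (q 0 / real (2 * N + 1))" unfolding S using M by (intro mult_left_mono) auto
  then show ?thesis by (simp add: q_def L2_inner_self)
qed

text \<open>The convolution of \<open>f\<close> with the finite comb that has weight
  \<open>w p\<close> at \<open>- x p\<close>.\<close>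

definition superpose :: "'p set \<Rightarrow> ('p \<Rightarrow> complex) \<Rightarrow> ('p \<Rightarrow> real ^ 'd) \<Rightarrow> (real ^ 'd \<Rightarrow> complex) \<Rightarrow> real ^ 'd \<Rightarrow> complex" where
  "superpose P w x f z = (\<Sum>p\<in>P. w p * f (z + x p))"

lemma Cc_superpose: "Cc f \<Longrightarrow> Cc (superpose P w x f)"
  unfolding superpose_def by (intro Cc_intros)

text \<open>Convolutions with finite combs commute. This lets damping be transferred from the test
  function to a whole comb of supertile points.\<close>

lemma damping_superpose: "damping I D (superpose P w x f) = superpose P w x (damping I D f)"
proof
  fix z
  have "(\<Sum>k\<in>I. \<Sum>s\<in>D k. \<Sum>t\<in>D k. superpose P w x f (z + (s - t)))
    = (\<Sum>k\<in>I. \<Sum>s\<in>D k. \<Sum>p\<in>P. \<Sum>t\<in>D k. w p * f (z + (s - t) + x p))"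
    unfolding superpose_def by (intro sum.cong refl sum.swap)
  also have "\<dots> = (\<Sum>k\<in>I. \<Sum>p\<in>P. \<Sum>s\<in>D k. \<Sum>t\<in>D k. w p * f (z + (s - t) + x p))"
    by (intro sum.cong refl sum.swap)
  also have "\<dots> = (\<Sum>p\<in>P. \<Sum>k\<in>I. \<Sum>s\<in>D k. \<Sum>t\<in>D k. w p * f (z + (s - t) + x p))"
    by (rule sum.swap)
  also have "\<dots> = (\<Sum>p\<in>P. w p * (\<Sum>k\<in>I. \<Sum>s\<in>D k. \<Sum>t\<in>D k. f (z + x p + (s - t))))"
    by (simp add: sum_distrib_left add_ac)
  finally have *: "(\<Sum>k\<in>I. \<Sum>s\<in>D k. \<Sum>t\<in>D k. superpose P w x f (z + (s - t)))
    = (\<Sum>p\<in>P. w p * (\<Sum>k\<in>I. \<Sum>s\<in>D k. \<Sum>t\<in>D k. f (z + x p + (s - t))))" .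
  show "damping I D (superpose P w x f) z = superpose P w x (damping I D f) z"
    unfolding damping_def * unfolding superpose_def
    by (simp add: right_diff_distrib sum_subtractf sum_distrib_left mult.left_commute)
qed

lemma damping_funpow_superpose:
  "(damping I D ^^ n) (superpose P w x f) = superpose P w x ((damping I D ^^ n) f)"
  by (induction n) (auto simp: damping_superpose)

section \<open>Damping on the Fourier side\<close>

lemma inverse_fourier_shift:
  assumes "Cc f"
  shows "inverse_fourier (\<lambda>z. f (z + t)) k = exp (- (2 * pi * \<i> * complex_of_real (t \<bullet> k))) * inverse_fourier f k"
proof -
  define g where "g x = exp (2 * pi * \<i> * complex_of_real (k \<bullet> x)) * f x" for x
  have "Cc g" unfolding g_def
    by (rule Cc_mult_left[OF assms]) (intro continuous_intros)
  have "inverse_fourier (\<lambda>z. f (z + t)) k = (\<integral>x. exp (- (2 * pi * \<i> * complex_of_real (t \<bullet> k))) * g (x + t) \<partial>lborel)"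
    unfolding inverse_fourier_def
  proof (rule Bochner_Integration.integral_cong[OF refl])
    fix x
    have "exp (- (2 * pi * \<i> * complex_of_real (t \<bullet> k))) * exp (2 * pi * \<i> * complex_of_real (k \<bullet> (x + t)))
      = exp (2 * pi * \<i> * complex_of_real (k \<bullet> x))"
      by (simp add: exp_add[symmetric] inner_add_right inner_commute algebra_simps)
    then show "exp (2 * pi * \<i> * complex_of_real (k \<bullet> x)) * f (x + t) = exp (- (2 * pi * \<i> * complex_of_real (t \<bullet> k))) * g (x + t)"
      unfolding g_def by (simp only: mult.assoc[symmetric])
  qed
  also have "\<dots> = exp (- (2 * pi * \<i> * complex_of_real (t \<bullet> k))) * inverse_fourier f k"
    using Cc_integral_shift[OF \<open>Cc g\<close>, of t] by (simp add: inverse_fourier_def g_def)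
  finally show ?thesis .
qed

lemma inverse_fourier_linear:
  assumes "Cc f" "Cc g"
  shows "inverse_fourier (\<lambda>z. f z - a * g z) k = inverse_fourier f k - a * inverse_fourier g k"
proof -
  have "integrable lborel (\<lambda>x. exp (2 * pi * \<i> * complex_of_real (k \<bullet> x)) * h x)" if "Cc h" for h
    by (intro Cc_integrable Cc_mult_left[OF that] continuous_intros)
  then show ?thesis using assms unfolding inverse_fourier_def
    by (simp add: right_diff_distrib mult.left_commute[of _ a])
qed

lemma inverse_fourier_sum:
  assumes "\<And>p. p \<in> P \<Longrightarrow> Cc (F p)"
  shows "inverse_fourier (\<lambda>z. \<Sum>p\<in>P. F p z) k = (\<Sum>p\<in>P. inverse_fourier (F p) k)"
proof -
  have "integrable lborel (\<lambda>x. exp (2 * pi * \<i> * complex_of_real (k \<bullet> x)) * F p x)" if "p \<in> P" for p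
    by (intro Cc_integrable Cc_mult_left[OF assms[OF that]] continuous_intros)
  then show ?thesis unfolding inverse_fourier_def sum_distrib_left
    by (intro Bochner_Integration.integral_sum)
qed

text \<open>Shifts become phases, and the double sum over differences of \<open>D j\<close> factors
  into an exponential sum times its conjugate. Damping is therefore multiplication by a real
  function of \<open>k\<close>.\<close>

lemma inverse_fourier_damping:
  assumes "Cc f"
  shows "inverse_fourier (damping I D f) k
    = complex_of_real (1 - (\<Sum>j\<in>I. (norm (\<Sum>t\<in>D j. exp (2 * pi * \<i> * complex_of_real (t \<bullet> k))))\<^sup>2) / square_card_sum I D)
      * inverse_fourier f k"
proof -
  define e where "e t = exp (2 * pi * \<i> * complex_of_real (t \<bullet> k))" for t
  have e: "exp (- (2 * pi * \<i> * complex_of_real ((s - t) \<bullet> k))) = cnj (e s) * e t" for s t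
    unfolding e_def exp_cnj exp_add[symmetric] by (simp add: inner_diff_left algebra_simps)
  have "inverse_fourier (\<lambda>z. \<Sum>j\<in>I. \<Sum>s\<in>D j. \<Sum>t\<in>D j. f (z + (s - t))) k
    = (\<Sum>j\<in>I. \<Sum>s\<in>D j. \<Sum>t\<in>D j. cnj (e s) * e t * inverse_fourier f k)"
    by (simp only: inverse_fourier_sum Cc_intros assms inverse_fourier_shift e)
  also have "\<dots> = (\<Sum>j\<in>I. cnj (\<Sum>s\<in>D j. e s) * (\<Sum>t\<in>D j. e t)) * inverse_fourier f k"
  proof -
    have "cnj (\<Sum>s\<in>D j. e s) * (\<Sum>t\<in>D j. e t) = (\<Sum>s\<in>D j. \<Sum>t\<in>D j. cnj (e s) * e t)" for j
      by (simp only: cnj_sum sum_product)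
    then show ?thesis by (simp only: sum_distrib_right)
  qed
  also have "(\<Sum>j\<in>I. cnj (\<Sum>s\<in>D j. e s) * (\<Sum>t\<in>D j. e t)) = complex_of_real (\<Sum>j\<in>I. (norm (\<Sum>t\<in>D j. e t))\<^sup>2)"
    unfolding of_real_sum by (intro sum.cong refl) (metis complex_norm_square mult.commute)
  finally have *: "inverse_fourier (\<lambda>z. \<Sum>j\<in>I. \<Sum>s\<in>D j. \<Sum>t\<in>D j. f (z + (s - t))) k
    = complex_of_real (\<Sum>j\<in>I. (norm (\<Sum>t\<in>D j. e t))\<^sup>2) * inverse_fourier f k" .
  have "inverse_fourier (damping I D f) k = inverse_fourier f k - complex_of_real (1 / square_card_sum I D) *
      inverse_fourier (\<lambda>z. \<Sum>j\<in>I. \<Sum>s\<in>D j. \<Sum>t\<in>D j. f (z + (s - t))) k"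
    unfolding damping_def by (intro inverse_fourier_linear Cc_intros assms)
  then show ?thesis unfolding * e_def[symmetric] by (simp add: algebra_simps)
qed

lemma inverse_fourier_damping_funpow:
  assumes "Cc f"
  shows "inverse_fourier ((damping I D ^^ n) f) k
    = complex_of_real (1 - (\<Sum>j\<in>I. (norm (\<Sum>t\<in>D j. exp (2 * pi * \<i> * complex_of_real (t \<bullet> k))))\<^sup>2) / square_card_sum I D) ^ n
      * inverse_fourier f k"
  by (induction n) (simp_all only: funpow.simps o_apply inverse_fourier_damping[OF Cc_damping_funpow[OF assms]]
      power_Suc mult.assoc power_0 id_apply mult_1)

text \<open>Pair correlations converge only against \<open>Cc\<close> functions, so
  self-convolutions have to be of this kind before the limit can be applied to them. Continuity is
  dominated convergence, as \<open>f\<close> is bounded.\<close>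

lemma Cc_self_convolution:
  assumes "Cc f"
  shows "Cc (self_convolution f)"
proof -
  obtain R where R: "\<And>z. norm z > R \<Longrightarrow> f z = 0" using Cc_support[OF assms] by metis
  have "self_convolution f x = 0" if "norm x > 2 * R" for x
  proof -
    have "f y * cnj (f (y - x)) = 0" for y
    proof (cases "norm y > R")
      case False
      then have "norm (y - x) > R" using that norm_triangle_ineq2[of x y] by (simp add: norm_minus_commute)
      then show ?thesis using R by simp
    qed (simp add: R)
    then have "(\<lambda>y. f y * cnj (f (y - x))) = (\<lambda>_. 0)" by (rule ext)
    then show ?thesis unfolding self_convolution_def by (simp only: Bochner_Integration.integral_zero)
  qed
  moreover have "continuous_on UNIV (self_convolution f)"
  proof -
    have f: "continuous_on UNIV f" by (rule Cc_continuous[OF assms])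
    have "bounded (range f)"
    proof -
      have "bounded (f ` cball 0 R)"
        by (intro compact_imp_bounded compact_continuous_image continuous_on_subset[OF f]) auto
      moreover have "range f \<subseteq> insert 0 (f ` cball 0 R)" using R by force
      ultimately show ?thesis by (meson bounded_insert bounded_subset)
    qed
    then obtain C where C: "\<And>z. norm (f z) \<le> C" unfolding bounded_iff by auto
    have meas: "(\<lambda>y. f y * cnj (f (y - v))) \<in> borel_measurable lborel" for v
      using Cc_integrable[OF Cc_mult_cnj[OF assms Cc_shift[OF assms, of "- v"]]] by simp
    show ?thesis
    proof (rule continuous_at_imp_continuous_on, rule ballI)
      fix x :: "real ^ 'a"
      show "isCont (self_convolution f) x"
        unfolding isCont_def tendsto_at_iff_sequentially comp_def
      proof (intro allI impI)
        fix X assume X: "X \<longlonglongrightarrow> x"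
        show "(\<lambda>n. self_convolution f (X n)) \<longlonglongrightarrow> self_convolution f x"
          unfolding self_convolution_def
        proof (rule integral_dominated_convergence[where w = "\<lambda>y. C * norm (f y)"])
          show "AE y in lborel. (\<lambda>n. f y * cnj (f (y - X n))) \<longlonglongrightarrow> f y * cnj (f (y - x))"
          proof (rule AE_I2)
            fix y
            have "isCont f (y - x)" using f by (simp add: continuous_on_eq_continuous_at)
            then have "(\<lambda>n. f (y - X n)) \<longlonglongrightarrow> f (y - x)"
              by (rule isCont_tendsto_compose) (intro tendsto_intros X)
            then show "(\<lambda>n. f y * cnj (f (y - X n))) \<longlonglongrightarrow> f y * cnj (f (y - x))"
              by (intro tendsto_intros)
          qed
          show "AE y in lborel. norm (f y * cnj (f (y - X n))) \<le> C * norm (f y)" for n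
            using C by (intro AE_I2) (simp add: norm_mult mult.commute[of C] mult_left_mono)
          show "integrable lborel (\<lambda>y. C * norm (f y))"
            using Cc_integrable[OF assms] by simp
        qed (rule meas)+
      qed
    qed
  qed
  ultimately show ?thesis unfolding Cc_iff by blast
qed

text \<open>A correlation sum tested with a self-convolution is a square integral. Through this
  identity the diffraction becomes accessible to estimates of superpositions.\<close>

lemma sum_self_convolution:
  assumes "Cc f" "finite P"
  shows "(\<Sum>p\<in>P. \<Sum>p'\<in>P. cnj (w p) * w p' * self_convolution f (x p' - x p))
    = complex_of_real (L2_sq (superpose P w x f))"
proof -
  have shift: "self_convolution f (x p' - x p) = (\<integral>z. f (z + x p') * cnj (f (z + x p)) \<partial>lborel)" for p p'
  proof -
    have "Cc (\<lambda>y. f y * cnj (f (y + (x p - x p'))))" by (intro Cc_mult_cnj Cc_intros assms)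
    from Cc_integral_shift[OF this, of "x p'"] show ?thesis
      by (simp add: self_convolution_def algebra_simps)
  qed
  have "complex_of_real (L2_sq (superpose P w x f)) = L2_inner (superpose P w x f) (superpose P w x f)"
    by (simp add: L2_inner_self)
  also have "\<dots> = (\<integral>z. (\<Sum>p'\<in>P. \<Sum>p\<in>P. (w p' * cnj (w p)) * (f (z + x p') * cnj (f (z + x p)))) \<partial>lborel)"
    unfolding L2_inner_def superpose_def by (simp add: sum_product mult_ac)
  also have "\<dots> = (\<Sum>p'\<in>P. \<Sum>p\<in>P. (w p' * cnj (w p)) * self_convolution f (x p' - x p))"
    by (simp add: Bochner_Integration.integral_sum Bochner_Integration.integrable_sum
        Cc_integrable Cc_mult_cnj Cc_intros assms shift)
  also have "\<dots> = (\<Sum>p\<in>P. \<Sum>p'\<in>P. cnj (w p) * w p' * self_convolution f (x p' - x p))"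
    by (subst sum.swap) (simp add: mult_ac)
  finally show ?thesis ..
qed

section \<open>The diffraction of supertiles\<close>

text \<open>The disjunction covers the case that \<open>dens\<close> evaluates to 0. The quotients
  defining the pair correlations then carry no information, but the autocorrelation has the same
  factor and the integral vanishes. Otherwise the density cancels.\<close>

lemma diffraction_integral_limit:
  fixes c :: "'n::finite \<Rightarrow> real ^ 'd"
  assumes corr: "\<And>i j. is_pair_correlation (control_points c W) i j (\<Upsilon> i j)"
    and ft: "is_fourier_transform (autocorrelation (dens (\<Union>i. control_points c W i)) \<Upsilon> u) \<mu>"
    and g: "Cc g"
    and fin: "\<And>r. finite {p \<in> W. norm (control_point c p) < r}"
  shows "(\<integral>k. (norm (inverse_fourier g k))\<^sup>2 \<partial>\<mu>) = 0 \<or>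
    ((\<lambda>r. L2_sq (superpose {p \<in> W. norm (control_point c p) < r} (u \<circ> fst) (control_point c) g)
       / measure lborel (ball (0 :: real ^ 'd) r)) \<longlongrightarrow> (\<integral>k. (norm (inverse_fourier g k))\<^sup>2 \<partial>\<mu>)) at_top"
proof -
  define \<delta> where "\<delta> = dens (\<Union>i. control_points c W i)"
  define J where "J = (\<integral>k. (norm (inverse_fourier g k))\<^sup>2 \<partial>\<mu>)"
  define h where "h = self_convolution g"
  define P where "P r = {p \<in> W. norm (control_point c p) < r}" for r
  define vol where "vol r = measure lborel (ball (0 :: real ^ 'd) r)" for r
  define S where "S i j r = (\<Sum>x\<in>control_points c W i \<inter> ball 0 r. \<Sum>y\<in>control_points c W j \<inter> ball 0 r. h (y - x))" for i j r
  have J: "complex_of_real J = complex_of_real \<delta> * (\<Sum>i\<in>UNIV. \<Sum>j\<in>UNIV. cnj (u i) * (\<integral>z. h z \<partial>\<Upsilon> i j) * u j)"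
    using ft g unfolding is_fourier_transform_def J_def h_def \<delta>_def autocorrelation_def by blast
  have lim: "((\<lambda>r. S i j r / complex_of_real (\<delta> * vol r)) \<longlongrightarrow> (\<integral>z. h z \<partial>\<Upsilon> i j)) at_top" for i j
    using corr[of i j] Cc_self_convolution[OF g]
    unfolding is_pair_correlation_def S_def h_def \<delta>_def vol_def by blast
  have points: "control_points c W i \<inter> ball 0 r = control_point c ` {p \<in> P r. fst p = i}" for i r
    unfolding control_points_def P_def control_point_def by (force simp: image_iff)
  have inj: "inj_on (control_point c) {p \<in> P r. fst p = i}" for i r
    by (auto simp: inj_on_def control_point_def)
  have finP: "finite (P r)" for r unfolding P_def by (rule fin)
  have group: "(\<Sum>i\<in>UNIV. \<Sum>p\<in>{p \<in> P r. fst p = i}. \<phi> p) = (\<Sum>p\<in>P r. \<phi> p)" for r and \<phi> :: "_ \<Rightarrow> complex"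
    by (rule sum.group) (auto simp: finP)
  have total: "(\<Sum>i\<in>UNIV. \<Sum>j\<in>UNIV. cnj (u i) * S i j r * u j)
      = complex_of_real (L2_sq (superpose (P r) (u \<circ> fst) (control_point c) g))" for r
  proof -
    have "(\<Sum>i\<in>UNIV. \<Sum>j\<in>UNIV. cnj (u i) * S i j r * u j)
      = (\<Sum>i\<in>UNIV. \<Sum>j\<in>UNIV. \<Sum>p\<in>{p \<in> P r. fst p = i}. \<Sum>p'\<in>{p' \<in> P r. fst p' = j}.
          cnj (u (fst p)) * u (fst p') * h (control_point c p' - control_point c p))"
      unfolding S_def points sum.reindex[OF inj]
      by (intro sum.cong refl, unfold o_def sum_distrib_left sum_distrib_right, intro sum.cong refl) auto
    also have "\<dots> = (\<Sum>i\<in>UNIV. \<Sum>p\<in>{p \<in> P r. fst p = i}. \<Sum>j\<in>UNIV. \<Sum>p'\<in>{p' \<in> P r. fst p' = j}.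
          cnj (u (fst p)) * u (fst p') * h (control_point c p' - control_point c p))"
      by (intro sum.cong refl sum.swap)
    also have "\<dots> = (\<Sum>p\<in>P r. \<Sum>p'\<in>P r. cnj (u (fst p)) * u (fst p') * h (control_point c p' - control_point c p))"
      unfolding group ..
    also have "\<dots> = complex_of_real (L2_sq (superpose (P r) (u \<circ> fst) (control_point c) g))"
      using sum_self_convolution[OF g finP[of r], of "u \<circ> fst" "control_point c"] by (simp add: h_def)
    finally show ?thesis .
  qed
  show ?thesis
  proof (cases "\<delta> = 0")
    case True
    then have "J = 0" using J by simp
    then show ?thesis unfolding J_def by blast
  next
    case False
    have "((\<lambda>r. complex_of_real \<delta> * (\<Sum>i\<in>UNIV. \<Sum>j\<in>UNIV. cnj (u i) * (S i j r / complex_of_real (\<delta> * vol r)) * u j)) \<longlongrightarrow> complex_of_real J) at_top"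
      unfolding J by (intro tendsto_intros lim)
    moreover have "complex_of_real \<delta> * (\<Sum>i\<in>UNIV. \<Sum>j\<in>UNIV. cnj (u i) * (S i j r / complex_of_real (\<delta> * vol r)) * u j)
      = complex_of_real (L2_sq (superpose (P r) (u \<circ> fst) (control_point c) g) / vol r)" for r
    proof -
      have "complex_of_real \<delta> * (\<Sum>i\<in>UNIV. \<Sum>j\<in>UNIV. cnj (u i) * (S i j r / complex_of_real (\<delta> * vol r)) * u j)
        = (\<Sum>i\<in>UNIV. \<Sum>j\<in>UNIV. cnj (u i) * S i j r * u j) / complex_of_real (vol r)"
        using False by (simp add: sum_distrib_left sum_divide_distrib)
      then show ?thesis unfolding total by simp
    qed
    ultimately have "((\<lambda>r. L2_sq (superpose (P r) (u \<circ> fst) (control_point c) g) / vol r) \<longlongrightarrow> J) at_top"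
      by (simp only: tendsto_of_real_iff)
    then show ?thesis unfolding J_def P_def vol_def by blast
  qed
qed

lemma sum_over_rule:
  fixes \<rho> :: "'n::finite \<Rightarrow> ('n, 'd::finite) patch" and G :: "real ^ 'd \<Rightarrow> complex"
  assumes "finite (\<rho> j)"
  shows "(\<Sum>(i, t)\<in>\<rho> j. u i * G (t + c i - Q *v c j)) = (\<Sum>i\<in>UNIV. u i * (\<Sum>d\<in>displacements Q \<rho> c i j. G d))"
proof -
  let ?\<phi> = "\<lambda>p. snd p + c (fst p) - Q *v c j"
  have "(\<Sum>d\<in>displacements Q \<rho> c i j. G d) = (\<Sum>p\<in>{p \<in> \<rho> j. fst p = i}. G (?\<phi> p))" for i
  proof -
    have "displacements Q \<rho> c i j = ?\<phi> ` {p \<in> \<rho> j. fst p = i}"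
      unfolding displacements_def by force
    moreover have "inj_on ?\<phi> {p \<in> \<rho> j. fst p = i}" by (auto simp: inj_on_def)
    ultimately show ?thesis by (simp only: sum.reindex o_def)
  qed
  then have "(\<Sum>i\<in>UNIV. u i * (\<Sum>d\<in>displacements Q \<rho> c i j. G d))
    = (\<Sum>i\<in>UNIV. \<Sum>p\<in>{p \<in> \<rho> j. fst p = i}. u (fst p) * G (?\<phi> p))"
    by (simp add: sum_distrib_left)
  also have "\<dots> = (\<Sum>p\<in>\<rho> j. u (fst p) * G (?\<phi> p))"
    by (rule sum.group) (auto simp: assms)
  finally show ?thesis by (simp add: case_prod_unfold)
qed

text \<open>The renormalisation step in physical space: a control point is \<open>Q\<close> times
  that of its parent plus a displacement that, for given types, ranges over the same set for every
  parent. The translate sums are the entries of the Fourier matrix, acting on one comb for each type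
  of supertile.\<close>

lemma superpose_inflate:
  fixes \<rho> :: "'n::finite \<Rightarrow> ('n, 'd::finite) patch"
  assumes "regular_prototiles T" "dissection Q T \<rho>" "nonoverlapping T P" "finite P"
  shows "superpose (inflate Q \<rho> P) (u \<circ> fst) (control_point c) g z
    = (\<Sum>(i, j)\<in>UNIV. u i * translate_sum (displacements Q \<rho> c i j)
        (superpose {p \<in> P. fst p = j} (\<lambda>_. 1) (\<lambda>p. Q *v control_point c p) g) z)"
proof -
  have fin: "finite (\<rho> j)" for j using assms(2) unfolding dissection_def by blast
  let ?G = "\<lambda>p d. g (z + Q *v control_point c p + d)"
  have "superpose (inflate Q \<rho> P) (u \<circ> fst) (control_point c) g z
    = (\<Sum>(j, s)\<in>P. \<Sum>(i, t)\<in>\<rho> j. u i * g (z + (Q *v s + t + c i)))"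
    unfolding superpose_def by (subst sum_inflate[OF assms]) (simp add: control_point_def)
  also have "\<dots> = (\<Sum>p\<in>P. \<Sum>(i, t)\<in>\<rho> (fst p). u i * ?G p (t + c i - Q *v c (fst p)))"
    by (intro sum.cong refl) (auto simp: control_point_def matrix_vector_right_distrib algebra_simps)
  also have "\<dots> = (\<Sum>p\<in>P. \<Sum>i\<in>UNIV. u i * (\<Sum>d\<in>displacements Q \<rho> c i (fst p). ?G p d))"
    by (intro sum.cong refl sum_over_rule fin)
  also have "\<dots> = (\<Sum>j\<in>UNIV. \<Sum>p\<in>{p \<in> P. fst p = j}. \<Sum>i\<in>UNIV. u i * (\<Sum>d\<in>displacements Q \<rho> c i (fst p). ?G p d))"
    by (rule sum.group[symmetric]) (auto simp: assms)
  also have "\<dots> = (\<Sum>j\<in>UNIV. \<Sum>p\<in>{p \<in> P. fst p = j}. \<Sum>i\<in>UNIV. u i * (\<Sum>d\<in>displacements Q \<rho> c i j. ?G p d))"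
    by (intro sum.cong refl) auto
  also have "\<dots> = (\<Sum>j\<in>UNIV. \<Sum>i\<in>UNIV. \<Sum>p\<in>{p \<in> P. fst p = j}. u i * (\<Sum>d\<in>displacements Q \<rho> c i j. ?G p d))"
    by (intro sum.cong refl sum.swap)
  also have "\<dots> = (\<Sum>i\<in>UNIV. \<Sum>j\<in>UNIV. \<Sum>p\<in>{p \<in> P. fst p = j}. u i * (\<Sum>d\<in>displacements Q \<rho> c i j. ?G p d))"
    by (rule sum.swap)
  also have "\<dots> = (\<Sum>i\<in>UNIV. \<Sum>j\<in>UNIV. u i * (\<Sum>d\<in>displacements Q \<rho> c i j. \<Sum>p\<in>{p \<in> P. fst p = j}. ?G p d))"
  proof (intro sum.cong refl)
    fix i j
    have "(\<Sum>d\<in>displacements Q \<rho> c i j. \<Sum>p\<in>{p \<in> P. fst p = j}. ?G p d)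
      = (\<Sum>p\<in>{p \<in> P. fst p = j}. \<Sum>d\<in>displacements Q \<rho> c i j. ?G p d)" by (rule sum.swap)
    then show "(\<Sum>p\<in>{p \<in> P. fst p = j}. u i * (\<Sum>d\<in>displacements Q \<rho> c i j. ?G p d))
      = u i * (\<Sum>d\<in>displacements Q \<rho> c i j. \<Sum>p\<in>{p \<in> P. fst p = j}. ?G p d)"
      by (simp only: sum_distrib_left)
  qed
  also have "\<dots> = (\<Sum>(i, j)\<in>UNIV. u i * translate_sum (displacements Q \<rho> c i j)
        (superpose {p \<in> P. fst p = j} (\<lambda>_. 1) (\<lambda>p. Q *v control_point c p) g) z)"
    unfolding UNIV_Times_UNIV[symmetric] sum.cartesian_product[symmetric]
    by (simp add: translate_sum_def superpose_def add_ac)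
  finally show ?thesis .
qed

abbreviation displacement_family ::
  "real ^ 'd ^ 'd \<Rightarrow> ('n \<Rightarrow> ('n, 'd::finite) patch) \<Rightarrow> ('n \<Rightarrow> real ^ 'd) \<Rightarrow> 'n \<times> 'n \<Rightarrow> (real ^ 'd) set" where
  "displacement_family Q \<rho> c \<equiv> \<lambda>(i, j). displacements Q \<rho> c i j"

lemma square_card_sum_displacements_pos:
  fixes T :: "'n::finite \<Rightarrow> (real ^ 'd) set"
  assumes "regular_prototiles T" "dissection Q T \<rho>"
  shows "square_card_sum UNIV (displacement_family Q \<rho> c) > 0"
proof -
  define j :: 'n where "j = undefined"
  have "T j \<noteq> {}" using assms unfolding regular_prototiles_def by blast
  then have "\<rho> j \<noteq> {}" using assms unfolding dissection_def by (metis UN_empty empty_is_image)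
  then obtain i s where "(i, s) \<in> \<rho> j" by (metis ex_in_conv prod.collapse)
  then have ne: "displacements Q \<rho> c i j \<noteq> {}" unfolding displacements_def by blast
  have "displacements Q \<rho> c i j \<subseteq> (\<lambda>p. snd p + c i - Q *v c j) ` \<rho> j"
    unfolding displacements_def by force
  then have "finite (displacements Q \<rho> c i j)"
    using assms(2) unfolding dissection_def by (meson finite_imageI finite_subset)
  then have "card (displacements Q \<rho> c i j) > 0" using ne by (simp add: card_gt_0_iff)
  then have "0 < (real (card (displacement_family Q \<rho> c (i, j))))\<^sup>2" by simp
  also have "\<dots> \<le> square_card_sum UNIV (displacement_family Q \<rho> c)"
    unfolding square_card_sum_def by (rule member_le_sum) auto
  finally show ?thesis .
qed

text \<open>This is the merit of the Frobenius norm: its square is the very function of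
  \<open>k\<close> in the damping factor, so level sets of the norm are level sets of that
  factor.\<close>

lemma norm_fourier_matrix_sq:
  "(norm (fourier_matrix Q \<rho> c k))\<^sup>2 =
    (\<Sum>q\<in>UNIV. (norm (\<Sum>t\<in>displacement_family Q \<rho> c q. exp (2 * pi * \<i> * complex_of_real (t \<bullet> k))))\<^sup>2)"
proof -
  have "(norm (fourier_matrix Q \<rho> c k))\<^sup>2 = (\<Sum>i\<in>UNIV. \<Sum>j\<in>UNIV. (norm (fourier_matrix Q \<rho> c k $ i $ j))\<^sup>2)"
    by (simp add: norm_vec_def L2_set_def sum_nonneg)
  also have "\<dots> = (\<Sum>q\<in>UNIV. (norm (\<Sum>t\<in>displacement_family Q \<rho> c q. exp (2 * pi * \<i> * complex_of_real (t \<bullet> k))))\<^sup>2)"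
    unfolding UNIV_Times_UNIV[symmetric] sum.cartesian_product'
    by (simp add: fourier_matrix_def)
  finally show ?thesis .
qed

lemma supertile_control_point:
  "control_point c (i, Q *v s + t) = Q *v control_point c (j, s) + (t + c i - Q *v c j)"
  by (simp add: control_point_def matrix_vector_right_distrib algebra_simps)

text \<open>
  Writing the points in a ball as points in supertiles, up to a boundary layer, turns the damped
  function into a sum of functions to which \<open>damping_power_bound\<close> applies.  What remains are sums
  of translates of \<open>f\<close> by the control points of the supertiles; since these are at least as sparse
  as the control points themselves, \<open>C\<close> does not depend on the inflation.
\<close>

lemma damped_diffraction_bound:
  fixes T :: "'n::finite \<Rightarrow> (real ^ 'd) set"
  assumes reg: "regular_prototiles T" and W: "nonoverlapping T W"
    and corr: "\<And>i j. is_pair_correlation (control_points c W) i j (\<Upsilon> i j)"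
    and ft: "is_fourier_transform (autocorrelation (dens (\<Union>i. control_points c W i)) \<Upsilon> u) \<mu>"
    and f: "Cc f"
  obtains C where "C \<ge> 0" "\<And>Q \<rho> N. dissection Q T \<rho> \<Longrightarrow> inflate Q \<rho> W = W \<Longrightarrow>
      (\<integral>k. (norm (inverse_fourier ((damping UNIV (displacement_family Q \<rho> c) ^^ N) f) k))\<^sup>2 \<partial>\<mu>)
        \<le> C * square_card_sum UNIV (displacement_family Q \<rho> c) / (\<bar>det Q\<bar> * real (2 * N + 1))"
proof -
  define vol where "vol r = measure lborel (ball (0 :: real ^ 'd) r)" for r
  have vol_nonneg: "vol r \<ge> 0" for r unfolding vol_def by simp
  obtain v a where v: "v > 0" and a: "a > 0" and count: "\<And>W P U. nonoverlapping T W \<Longrightarrow> P \<subseteq> W \<Longrightarrow> bounded U \<Longrightarrow>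
      U \<in> sets borel \<Longrightarrow> (\<And>p. p \<in> P \<Longrightarrow> ball (control_point c p) a \<subseteq> U) \<Longrightarrow>
       finite P \<and> real (card P) * v \<le> measure lborel U"
    using tile_counting[OF reg, of c] by metis
  obtain R0 where R0: "R0 > 0" "\<And>Q \<rho> x. dissection Q T \<rho> \<Longrightarrow> norm x \<le> R0 * norm (Q *v x)"
    using dissection_inverse_bounded[OF reg] by metis
  have near: "real (card {p' \<in> P. norm (control_point c p' - x) \<le> s}) \<le> vol (s + a) / v"
    if "P \<subseteq> W" "s \<ge> 0" for P x s
  proof -
    have "ball (control_point c p') a \<subseteq> ball x (s + a)" if "norm (control_point c p' - x) \<le> s" for p'
    proof
      fix y assume "y \<in> ball (control_point c p') a"
      then show "y \<in> ball x (s + a)"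
        using that dist_triangle[of x y "control_point c p'"] by (simp add: dist_norm norm_minus_commute)
    qed
    then have "real (card {p' \<in> P. norm (control_point c p' - x) \<le> s}) * v \<le> measure lborel (ball x (s + a))"
      using count[OF W, of "{p' \<in> P. norm (control_point c p' - x) \<le> s}" "ball x (s + a)"] that by auto
    also have "measure lborel (ball x (s + a)) = vol (s + a)"
      unfolding vol_def using that a by (simp add: content_ball)
    finally show ?thesis using v by (simp add: pos_le_divide_eq)
  qed
  have fin: "finite {p \<in> W. norm (control_point c p) < r}" for r
  proof -
    have "ball (control_point c p) a \<subseteq> ball 0 (r + a)" if "norm (control_point c p) < r" for p
    proof
      fix y assume "y \<in> ball (control_point c p) a"
      then show "y \<in> ball 0 (r + a)"
        using that dist_triangle[of 0 y "control_point c p"] by (simp add: dist_norm norm_minus_commute)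
    qed
    then show ?thesis using count[OF W, of "{p \<in> W. norm (control_point c p) < r}" "ball 0 (r + a)"] by auto
  qed
  obtain R where R: "R > 0" "\<And>z. norm z > R \<Longrightarrow> f z = 0" using Cc_support[OF f] by metis
  \<comment> \<open>If \<open>Q\<close>-images of two points are at most \<open>2 * R\<close> apart,
    then the points are at most \<open>R0 * (2 * R)\<close> apart. So \<open>K\<close> bounds the
    overlap of translates of \<open>f\<close> by supertile points for every dissection at
    once.\<close>
  define K where "K = vol (R0 * (2 * R) + a) / v"
  have K: "K \<ge> 0" unfolding K_def using v vol_nonneg by simp
  \<comment> \<open>The weight factor of the Cauchy-Schwarz bound for the sum over all pairs of
    types.\<close>
  define A where "A = (\<Sum>q\<in>(UNIV :: ('n \<times> 'n) set). (norm (u (fst q)))\<^sup>2)"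
  have A: "A \<ge> 0" unfolding A_def by (simp add: sum_nonneg)
  show thesis
  proof (rule that)
    \<comment> \<open>The factor 2 comes from splitting off the boundary term, and
      \<open>1 / v\<close> from counting supertile points.\<close>
    show "2 * A * K * L2_sq f / v \<ge> 0" using A K L2_sq_nonneg[of f] v by simp
    fix Q \<rho> N
    assume Q: "dissection Q T \<rho>" and QW: "inflate Q \<rho> W = W"
    let ?cp = "control_point c"
    let ?D = "displacement_family Q \<rho> c"
    let ?Y = "damping UNIV ?D ^^ N"
    define g where "g = ?Y f"
    define M where "M = square_card_sum UNIV ?D"
    define \<Delta> where "\<Delta> = \<bar>det Q\<bar>"
    define n where "n = real (2 * N + 1)"
    have inv: "invertible Q" using Q unfolding dissection_def by blast
    then have \<Delta>: "\<Delta> > 0" unfolding \<Delta>_def by (simp add: invertible_det_nz)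
    have M: "M > 0" unfolding M_def by (rule square_card_sum_displacements_pos[OF reg Q])
    have g: "Cc g" unfolding g_def by (rule Cc_damping_funpow[OF f])
    have n: "n > 0" unfolding n_def by simp
    obtain l where l: "l > 0" "\<And>x. norm (Q *v x) \<le> norm x * l"
      using bounded_linear.pos_bounded[OF matrix_vector_mul_bounded_linear[of Q]] by blast
    obtain b where b: "b > 0" "\<And>i j t. (i, t) \<in> \<rho> j \<Longrightarrow> norm (t + c i - Q *v c j) < b"
    proof -
      have "finite (\<Union>j. (\<lambda>(i, t). t + c i - Q *v c j) ` \<rho> j)"
        using Q unfolding dissection_def by auto
      then have "bounded (\<Union>j. (\<lambda>(i, t). t + c i - Q *v c j) ` \<rho> j)" by (rule finite_imp_bounded)
      then obtain b where b: "\<forall>x\<in>(\<Union>j. (\<lambda>(i, t). t + c i - Q *v c j) ` \<rho> j). norm x \<le> b"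
        unfolding bounded_iff by blast
      have b: "norm (t + c i - Q *v c j) \<le> b" if "(i, t) \<in> \<rho> j" for i j t
      proof -
        have "t + c i - Q *v c j \<in> (\<Union>j. (\<lambda>(i, t). t + c i - Q *v c j) ` \<rho> j)" using that by force
        then show ?thesis using b by blast
      qed
      show thesis
      proof (rule that)
        show "\<bar>b\<bar> + 1 > 0" by simp
        show "norm (t + c i - Q *v c j) < \<bar>b\<bar> + 1" if "(i, t) \<in> \<rho> j" for i j t using b[OF that] by linarith
      qed
    qed
    define P where "P r = {p \<in> W. norm (?cp p) < r}" for r
    \<comment> \<open>As \<open>b\<close> exceeds every displacement, \<open>P' r\<close> contains
      the parents of all tiles in \<open>P r\<close>, and its own children have control points of
      norm below \<open>r + 2 * b\<close>. \<open>E r\<close> is the surplus near the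
      boundary.\<close>
    define P' where "P' r = {q \<in> W. norm (Q *v ?cp q) < r + b}" for r
    define E where "E r = inflate Q \<rho> (P' r) - P r" for r
    define B1 where "B1 r = A * (M / n * (K * (vol (r + (b + a * l)) / (\<Delta> * v)) * L2_sq f))" for r
    obtain R' where R': "R' > 0" "\<And>z. norm z > R' \<Longrightarrow> g z = 0" using Cc_support[OF g] by metis
    define \<omega> where "\<omega> = (\<Sum>i\<in>UNIV. norm (u i))"
    have \<omega>: "norm (u i) \<le> \<omega>" for i unfolding \<omega>_def by (rule member_le_sum) auto
    \<comment> \<open>This overlap bound for \<open>g\<close> depends on the rule and on
      \<open>N\<close>, which is harmless: it enters the boundary term only, and that term vanishes
      in the limit.\<close>
    define K' where "K' = vol (2 * R' + a) / v"
    have K': "K' \<ge> 0" unfolding K'_def using v vol_nonneg by simp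
    define B2 where "B2 r = \<omega>\<^sup>2 * K' * ((vol (r + (2 * b + a)) - vol (r + (- a))) / v) * L2_sq g" for r
    have P'W: "P' r \<subseteq> W" for r unfolding P'_def by blast
    have no: "nonoverlapping T (P' r)" for r
      using W P'W unfolding nonoverlapping_def by (meson pairwise_subset)
    have P': "finite (P' r) \<and> real (card (P' r)) \<le> vol (r + (b + a * l)) / (\<Delta> * v)" for r
    proof -
      \<comment> \<open>A ball of radius \<open>a\<close> is stretched by \<open>Q\<close> at most
        to radius \<open>a * l\<close>, hence the additional margin.\<close>
      let ?U = "{x. norm (Q *v x) < r + (b + a * l)}"
      have "ball (?cp p) a \<subseteq> ?U" if "p \<in> P' r" for p
      proof
        fix y assume "y \<in> ball (?cp p) a"
        then have "norm (y - ?cp p) < a" by (simp add: dist_norm norm_minus_commute)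
        then have "norm (y - ?cp p) * l < a * l" using l by simp
        then have "norm (Q *v (y - ?cp p)) < a * l" using l(2)[of "y - ?cp p"] by linarith
        moreover have "Q *v y = Q *v ?cp p + Q *v (y - ?cp p)" by (simp add: matrix_vector_mult_diff_distrib)
        ultimately show "y \<in> ?U"
          using that norm_triangle_ineq[of "Q *v ?cp p" "Q *v (y - ?cp p)"] unfolding P'_def by simp
      qed
      then have "finite (P' r) \<and> real (card (P' r)) * v \<le> measure lborel ?U"
        using measure_matrix_preimage_ball[OF inv] by (intro count[OF W P'W]) auto
      then show ?thesis
        using measure_matrix_preimage_ball(1)[OF inv] v \<Delta> by (simp add: vol_def \<Delta>_def field_simps)
    qed
    have inflate_P': "\<exists>q d. q \<in> P' r \<and> norm d < b \<and> ?cp p = Q *v ?cp q + d" if "p \<in> inflate Q \<rho> (P' r)" for p r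
    proof -
      obtain i x where p: "p = (i, x)" by fastforce
      have "(i, x) \<in> inflate Q \<rho> (P' r)" using that p by simp
      then obtain j s t where *: "(j, s) \<in> P' r" "(i, t) \<in> \<rho> j" "x = Q *v s + t"
        unfolding mem_inflate by blast
      have "?cp p = Q *v ?cp (j, s) + (t + c i - Q *v c j)"
        unfolding p *(3) by (rule supertile_control_point)
      then show ?thesis using b(2)[OF *(2)] *(1) by blast
    qed
    have P_sub: "P r \<subseteq> inflate Q \<rho> (P' r)" for r
    proof
      fix p assume p: "p \<in> P r"
      obtain i x where ix: "p = (i, x)" by fastforce
      have "(i, x) \<in> inflate Q \<rho> W" using p QW ix unfolding P_def by simp
      then obtain j s t where *: "(j, s) \<in> W" "(i, t) \<in> \<rho> j" "x = Q *v s + t"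
        unfolding mem_inflate by blast
      have "?cp p = Q *v ?cp (j, s) + (t + c i - Q *v c j)"
        unfolding ix *(3) by (rule supertile_control_point)
      then have "norm (Q *v ?cp (j, s)) \<le> norm (?cp p) + norm (t + c i - Q *v c j)"
        using norm_triangle_ineq4[of "?cp p" "t + c i - Q *v c j"] by simp
      also have "\<dots> < r + b" using p b(2)[OF *(2)] unfolding P_def by simp
      finally have "(j, s) \<in> P' r" using * unfolding P'_def by simp
      then show "p \<in> inflate Q \<rho> (P' r)" unfolding ix mem_inflate using * by blast
    qed
    have inflate_sub: "inflate Q \<rho> (P' r) \<subseteq> W" for r
    proof -
      have "inflate Q \<rho> (P' r) \<subseteq> inflate Q \<rho> W" unfolding inflate_def using P'W by blast
      then show ?thesis using QW by simp
    qed
    have fin_inflate: "finite (inflate Q \<rho> (P' r))" for r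
      using P'[of r] Q unfolding dissection_def inflate_def shift_def by auto
    have E: "finite (E r) \<and> real (card (E r)) \<le> (vol (r + (2 * b + a)) - vol (r + (- a))) / v" for r
    proof -
      \<comment> \<open>The surplus tiles lie in a shell of fixed width, whose volume is negligible
        against that of the ball.\<close>
      let ?U = "ball (0 :: real ^ 'd) (r + (2 * b + a)) - ball 0 (r + (- a))"
      have "E r \<subseteq> W" unfolding E_def using inflate_sub by blast
      moreover have "ball (?cp p) a \<subseteq> ?U" if "p \<in> E r" for p
      proof
        fix y assume "y \<in> ball (?cp p) a"
        then have y: "norm (y - ?cp p) < a" by (simp add: dist_norm norm_minus_commute)
        have "norm (?cp p) \<ge> r" using that inflate_sub unfolding E_def P_def by force
        moreover have "norm (?cp p) < r + 2 * b"
        proof -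
          obtain q d where q: "q \<in> P' r" "norm d < b" "?cp p = Q *v ?cp q + d"
            using inflate_P' \<open>p \<in> E r\<close> unfolding E_def by blast
          then show ?thesis using norm_triangle_ineq[of "Q *v ?cp q" d] unfolding P'_def by simp
        qed
        ultimately show "y \<in> ?U"
          using y norm_triangle_ineq[of "?cp p" "y - ?cp p"] norm_triangle_ineq2[of "?cp p" "?cp p - y"]
          by (simp add: norm_minus_commute)
      qed
      ultimately have "finite (E r) \<and> real (card (E r)) * v \<le> measure lborel ?U"
        by (intro count[OF W]) (auto intro: bounded_subset[OF bounded_ball Diff_subset])
      moreover have "measure lborel ?U = vol (r + (2 * b + a)) - vol (r + (- a))"
        unfolding vol_def using a b
        by (intro measurable_measure_Diff fmeasurableI) (auto simp: emeasure_lborel_ball_finite[simplified] intro: subset_ball)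
      ultimately show ?thesis using v by (simp add: pos_le_divide_eq)
    qed
    define main where "main r = superpose (inflate Q \<rho> (P' r)) (u \<circ> fst) ?cp g" for r
    \<comment> \<open>The minus sign removes the surplus tiles that \<open>main\<close> counts in
      excess.\<close>
    define rest where "rest r = superpose (E r) (\<lambda>p. - u (fst p)) ?cp g" for r
    have split: "superpose (P r) (u \<circ> fst) ?cp g = (\<lambda>z. main r z + rest r z)" for r
    proof
      fix z
      have "main r z = superpose (E r) (u \<circ> fst) ?cp g z + superpose (P r) (u \<circ> fst) ?cp g z"
        unfolding main_def E_def superpose_def by (rule sum.subset_diff[OF P_sub fin_inflate])
      then show "superpose (P r) (u \<circ> fst) ?cp g z = main r z + rest r z"
        unfolding rest_def superpose_def by (simp add: sum_negf)
    qed
    have rest: "L2_sq (rest r) \<le> B2 r" for r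
    proof -
      have "L2_sq (rest r) \<le> \<omega>\<^sup>2 * K' * real (card (E r)) * L2_sq g"
        unfolding rest_def superpose_def
      proof (rule L2_sq_bounded_overlap[OF _ g R'(2)])
        show "finite (E r)" using E by blast
        show "real (card {p' \<in> E r. norm (?cp p' - ?cp p) \<le> 2 * R'}) \<le> K'" for p
          unfolding K'_def using inflate_sub R'(1) by (intro near) (auto simp: E_def)
        show "norm (- u (fst p)) \<le> \<omega>" for p :: "'n \<times> (real ^ 'd)" using \<omega> by simp
      qed (use K' in auto)
      also have "\<dots> \<le> B2 r"
        unfolding B2_def using E K' L2_sq_nonneg by (intro mult_right_mono mult_left_mono) auto
      finally show ?thesis .
    qed
    define P'' where "P'' r j = {p \<in> P' r. fst p = j}" for r j
    define h where "h r j = superpose (P'' r j) (\<lambda>_. 1) (\<lambda>p. Q *v ?cp p) f" for r j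
    have h_Cc: "Cc (h r j)" for r j unfolding h_def by (rule Cc_superpose[OF f])
    have h: "L2_sq (h r j) \<le> K * real (card (P'' r j)) * L2_sq f" for r j
    proof -
      have "L2_sq (h r j) \<le> 1\<^sup>2 * K * real (card (P'' r j)) * L2_sq f"
        unfolding h_def superpose_def
      proof (rule L2_sq_bounded_overlap[OF _ f R(2)])
        show fin'': "finite (P'' r j)" using P'[of r] unfolding P''_def by simp
        fix p
        have "{p' \<in> P'' r j. norm (Q *v ?cp p' - Q *v ?cp p) \<le> 2 * R}
          \<subseteq> {p' \<in> P'' r j. norm (?cp p' - ?cp p) \<le> R0 * (2 * R)}"
        proof clarify
          fix i s assume "norm (Q *v ?cp (i, s) - Q *v ?cp p) \<le> 2 * R"
          then have "R0 * norm (Q *v (?cp (i, s) - ?cp p)) \<le> R0 * (2 * R)"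
            using R0(1) by (simp add: matrix_vector_mult_diff_distrib)
          then show "norm (?cp (i, s) - ?cp p) \<le> R0 * (2 * R)"
            using R0(2)[OF Q, of "?cp (i, s) - ?cp p"] by linarith
        qed
        then have "card {p' \<in> P'' r j. norm (Q *v ?cp p' - Q *v ?cp p) \<le> 2 * R}
          \<le> card {p' \<in> P'' r j. norm (?cp p' - ?cp p) \<le> R0 * (2 * R)}"
          using fin'' by (intro card_mono) auto
        also have "real \<dots> \<le> K"
          unfolding K_def using P'W R R0 by (intro near) (auto simp: P''_def)
        finally show "real (card {p' \<in> P'' r j. norm (Q *v ?cp p' - Q *v ?cp p) \<le> 2 * R}) \<le> K" by simp
      qed (use K in auto)
      then show ?thesis by simp
    qed
    have main: "L2_sq (main r) \<le> B1 r" for r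
    proof -
      have sum_pairs: "(\<Sum>q\<in>UNIV. F q) = (\<Sum>j\<in>UNIV. \<Sum>i\<in>UNIV. F (i, j))" for F :: "'n \<times> 'n \<Rightarrow> real"
        unfolding UNIV_Times_UNIV[symmetric] sum.cartesian_product' by (rule sum.swap)
      \<comment> \<open>The damping steps pass from \<open>f\<close> to the comb of all supertile
        points of type \<open>j\<close>. What they act on is a superposition of the undamped
        \<open>f\<close>, whose overlap is bounded by \<open>K\<close> whatever the rule and
        \<open>N\<close> are.\<close>
      have g_super: "superpose (P'' r j) (\<lambda>_. 1) (\<lambda>p. Q *v ?cp p) g = ?Y (h r j)" for j
        unfolding g_def h_def damping_funpow_superpose ..
      have "main r = (\<lambda>z. \<Sum>q\<in>UNIV. u (fst q) * translate_sum (?D q) (?Y (h r (snd q))) z)"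
        unfolding main_def
        using superpose_inflate[OF reg Q no, of r u c g] P'[of r]
        by (simp add: fun_eq_iff g_super flip: P''_def) (simp add: case_prod_unfold)
      then have "L2_sq (main r) \<le> A * (\<Sum>q\<in>UNIV. L2_sq (translate_sum (?D q) (?Y (h r (snd q)))))"
        unfolding A_def
        by (simp only:) (intro L2_sq_sum_weighted_le finite Cc_translate_sum Cc_damping_funpow h_Cc)
      also have "(\<Sum>q\<in>UNIV. L2_sq (translate_sum (?D q) (?Y (h r (snd q)))))
        = (\<Sum>j\<in>UNIV. \<Sum>i\<in>UNIV. L2_sq (translate_sum (?D (i, j)) (?Y (h r j))))"
        unfolding sum_pairs by simp
      \<comment> \<open>\<open>damping_power_bound\<close> sums over all pairs with the function
        held fixed, whereas here \<open>j\<close> determines both the function and the second index.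
        The added terms are nonnegative.\<close>
      also have "\<dots> \<le> (\<Sum>j\<in>UNIV. \<Sum>q\<in>UNIV. L2_sq (translate_sum (?D q) (?Y (h r j))))"
      proof (rule sum_mono)
        fix j
        have "(\<Sum>i\<in>UNIV. L2_sq (translate_sum (?D (i, j)) (?Y (h r j))))
          = (\<Sum>q\<in>(\<lambda>i. (i, j)) ` UNIV. L2_sq (translate_sum (?D q) (?Y (h r j))))"
          by (subst sum.reindex) (auto simp: inj_on_def)
        also have "\<dots> \<le> (\<Sum>q\<in>UNIV. L2_sq (translate_sum (?D q) (?Y (h r j))))"
          by (rule sum_mono2) (auto simp: L2_sq_nonneg)
        finally show "(\<Sum>i\<in>UNIV. L2_sq (translate_sum (?D (i, j)) (?Y (h r j))))
          \<le> (\<Sum>q\<in>UNIV. L2_sq (translate_sum (?D q) (?Y (h r j))))" .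
      qed
      also have "\<dots> \<le> (\<Sum>j\<in>UNIV. M / n * L2_sq (h r j))"
        unfolding M_def n_def by (intro sum_mono damping_power_bound h_Cc M[unfolded M_def])
      also have "\<dots> \<le> (\<Sum>j\<in>UNIV. M / n * (K * real (card (P'' r j)) * L2_sq f))"
        using M n by (intro sum_mono mult_left_mono h) auto
      also have "\<dots> = M / n * (K * real (\<Sum>j\<in>UNIV. card (P'' r j)) * L2_sq f)"
        by (simp add: sum_distrib_left sum_distrib_right)
      also have "(\<Sum>j\<in>UNIV. card (P'' r j)) = card (P' r)"
        unfolding P''_def card_eq_sum by (rule sum.group) (use P'[of r] in auto)
      also have "M / n * (K * real (card (P' r)) * L2_sq f)
        \<le> M / n * (K * (vol (r + (b + a * l)) / (\<Delta> * v)) * L2_sq f)"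
        using M n K P'[of r] L2_sq_nonneg by (intro mult_left_mono mult_right_mono) auto
      finally show ?thesis unfolding B1_def using A by (simp add: mult_left_mono)
    qed
    have Cc_main: "Cc (main r)" and Cc_rest: "Cc (rest r)" for r
      unfolding main_def rest_def by (rule Cc_superpose[OF g])+
    have bound: "L2_sq (superpose (P r) (u \<circ> fst) ?cp g) / vol r \<le> (2 * B1 r + 2 * B2 r) / vol r" for r
    proof (rule divide_right_mono[OF _ vol_nonneg])
      show "L2_sq (superpose (P r) (u \<circ> fst) ?cp g) \<le> 2 * B1 r + 2 * B2 r"
        unfolding split using L2_sq_add_le[OF Cc_main[of r] Cc_rest[of r]] main[of r] rest[of r] by linarith
    qed
    have ratio: "((\<lambda>r. vol (r + s) / vol r) \<longlongrightarrow> 1) at_top" for s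
      unfolding vol_def by (rule ball_volume_ratio)
    \<comment> \<open>The shell contributes a difference of two volume ratios, both tending to 1;
      only the supertile term survives.\<close>
    have "((\<lambda>r. 2 * (A * (M / n * (K * (vol (r + (b + a * l)) / vol r / (\<Delta> * v)) * L2_sq f)))
        + 2 * (\<omega>\<^sup>2 * K' * ((vol (r + (2 * b + a)) / vol r - vol (r + (- a)) / vol r) / v) * L2_sq g))
      \<longlongrightarrow> 2 * (A * (M / n * (K * (1 / (\<Delta> * v)) * L2_sq f)))
        + 2 * (\<omega>\<^sup>2 * K' * ((1 - 1) / v) * L2_sq g)) at_top"
      using \<Delta> v by (intro tendsto_intros ratio) auto
    moreover have "2 * (A * (M / n * (K * (1 / (\<Delta> * v)) * L2_sq f))) + 2 * (\<omega>\<^sup>2 * K' * ((1 - 1) / v) * L2_sq g)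
      = 2 * A * K * L2_sq f / v * M / (\<Delta> * n)"
      using \<Delta> v n by (simp add: field_simps)
    moreover have "2 * (A * (M / n * (K * (vol (r + (b + a * l)) / vol r / (\<Delta> * v)) * L2_sq f)))
        + 2 * (\<omega>\<^sup>2 * K' * ((vol (r + (2 * b + a)) / vol r - vol (r + (- a)) / vol r) / v) * L2_sq g)
      = (2 * B1 r + 2 * B2 r) / vol r" for r
      unfolding B1_def B2_def by (simp add: add_divide_distrib diff_divide_distrib[symmetric] mult_ac)
    ultimately have lim: "((\<lambda>r. (2 * B1 r + 2 * B2 r) / vol r) \<longlongrightarrow> 2 * A * K * L2_sq f / v * M / (\<Delta> * n)) at_top"
      by simp
    have "(\<integral>k. (norm (inverse_fourier g k))\<^sup>2 \<partial>\<mu>) \<le> 2 * A * K * L2_sq f / v * M / (\<Delta> * n)"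
      using diffraction_integral_limit[OF corr ft g fin]
    proof
      assume "(\<integral>k. (norm (inverse_fourier g k))\<^sup>2 \<partial>\<mu>) = 0"
      then show ?thesis using A K L2_sq_nonneg[of f] v M \<Delta> n by simp
    next
      assume "((\<lambda>r. L2_sq (superpose {p \<in> W. norm (?cp p) < r} (u \<circ> fst) ?cp g)
         / measure lborel (ball (0 :: real ^ 'd) r)) \<longlongrightarrow> (\<integral>k. (norm (inverse_fourier g k))\<^sup>2 \<partial>\<mu>)) at_top"
      then show ?thesis
        unfolding P_def[symmetric] vol_def[symmetric] using bound
        by (intro tendsto_le[OF _ lim]) auto
    qed
    then show "(\<integral>k. (norm (inverse_fourier (?Y f) k))\<^sup>2 \<partial>\<mu>)
        \<le> 2 * A * K * L2_sq f / v * square_card_sum UNIV ?D / (\<bar>det Q\<bar> * real (2 * N + 1))"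
      unfolding g_def M_def \<Delta>_def n_def .
  qed
qed

section \<open>Singularity of the diffraction\<close>

lemma norm_fourier_matrix_sq_le:
  "(norm (fourier_matrix Q \<rho> c k))\<^sup>2 \<le> square_card_sum UNIV (displacement_family Q \<rho> c)"
  unfolding norm_fourier_matrix_sq square_card_sum_def
proof (intro sum_mono power_mono)
  fix q
  have "norm (\<Sum>t\<in>displacement_family Q \<rho> c q. exp (2 * pi * \<i> * complex_of_real (t \<bullet> k)))
    \<le> (\<Sum>t\<in>displacement_family Q \<rho> c q. 1)"
    by (intro sum_norm_le) (simp add: norm_exp_eq_Re)
  then show "norm (\<Sum>t\<in>displacement_family Q \<rho> c q. exp (2 * pi * \<i> * complex_of_real (t \<bullet> k)))
    \<le> real (card (displacement_family Q \<rho> c q))" by simp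
qed simp

lemma closed_fourier_matrix_level: "closed {k. (norm (fourier_matrix Q \<rho> c k))\<^sup>2 \<le> s}"
  unfolding norm_fourier_matrix_sq by (intro closed_Collect_le continuous_intros)

text \<open>
  Where \<open>\<parallel>B(k)\<parallel>\<^sup>2 \<le> \<eta> \<bar>det Q\<bar>\<close>, about \<open>M / (4 \<eta> \<bar>det Q\<bar>)\<close> damping steps do not reduce the
  integrand by more than a factor \<open>2\<close>.
\<close>

lemma diffraction_level_bound:
  fixes T :: "'n::finite \<Rightarrow> (real ^ 'd) set"
  assumes reg: "regular_prototiles T" and W: "nonoverlapping T W"
    and corr: "\<And>i j. is_pair_correlation (control_points c W) i j (\<Upsilon> i j)"
    and ft: "is_fourier_transform (autocorrelation (dens (\<Union>i. control_points c W i)) \<Upsilon> u) \<mu>"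
    and f: "Cc f"
  shows "\<exists>C. \<forall>Q \<rho> \<eta>. dissection Q T \<rho> \<longrightarrow> inflate Q \<rho> W = W \<longrightarrow> \<eta> > 0 \<longrightarrow>
      (\<integral>k. indicator {k. (norm (fourier_matrix Q \<rho> c k))\<^sup>2 \<le> \<eta> * \<bar>det Q\<bar>} k
         * (norm (inverse_fourier f k))\<^sup>2 \<partial>\<mu>) \<le> C * \<eta>"
proof -
  obtain C where C: "C \<ge> 0" and bound: "\<And>Q \<rho> N. dissection Q T \<rho> \<Longrightarrow> inflate Q \<rho> W = W \<Longrightarrow>
      (\<integral>k. (norm (inverse_fourier ((damping UNIV (displacement_family Q \<rho> c) ^^ N) f) k))\<^sup>2 \<partial>\<mu>)
        \<le> C * square_card_sum UNIV (displacement_family Q \<rho> c) / (\<bar>det Q\<bar> * real (2 * N + 1))"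
    using damped_diffraction_bound[OF assms] by metis
  show ?thesis
  proof (intro exI allI impI)
    fix Q \<rho> and \<eta> :: real
    assume Q: "dissection Q T \<rho>" and QW: "inflate Q \<rho> W = W" and \<eta>: "\<eta> > 0"
    define M where "M = square_card_sum UNIV (displacement_family Q \<rho> c)"
    define \<Delta> where "\<Delta> = \<bar>det Q\<bar>"
    define \<phi> where "\<phi> k = (norm (inverse_fourier f k))\<^sup>2" for k
    define x where "x k = (norm (fourier_matrix Q \<rho> c k))\<^sup>2 / M" for k
    define S where "S = {k. (norm (fourier_matrix Q \<rho> c k))\<^sup>2 \<le> \<eta> * \<Delta>}"
    have "invertible Q" using Q unfolding dissection_def by blast
    then have \<Delta>: "\<Delta> > 0" unfolding \<Delta>_def by (simp add: invertible_det_nz)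
    have M: "M > 0" unfolding M_def by (rule square_card_sum_displacements_pos[OF reg Q])
    define \<theta> where "\<theta> = \<eta> * \<Delta> / M"
    have \<theta>: "\<theta> > 0" unfolding \<theta>_def using \<eta> \<Delta> M by simp
    \<comment> \<open>The largest \<open>N\<close> with \<open>2 * N * \<theta> \<le> 1 / 2\<close>:
      Bernoulli's inequality then keeps the damping factor above 1/2 on \<open>S\<close>, while
      rounding down still gives \<open>1 / (2 * N + 1) \<le> 4 * \<theta>\<close>, even when
      \<open>N = 0\<close>.\<close>
    define N where "N = nat \<lfloor>1 / (4 * \<theta>)\<rfloor>"
    have N_le: "real N \<le> 1 / (4 * \<theta>)" unfolding N_def using \<theta> by simp
    have "1 / (4 * \<theta>) < real N + 1" unfolding N_def using \<theta> by linarith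
    then have "1 < (real N + 1) * (4 * \<theta>)" using \<theta> by (simp only: pos_divide_less_eq)
    then have "1 / (real N + 1) \<le> 4 * \<theta>" by (simp add: pos_divide_le_eq mult.commute)
    moreover have "1 / real (2 * N + 1) \<le> 1 / (real N + 1)" by (intro frac_le) auto
    ultimately have N_ge: "1 / real (2 * N + 1) \<le> 4 * \<theta>" by linarith
    define g where "g = (damping UNIV (displacement_family Q \<rho> c) ^^ N) f"
    have x: "0 \<le> x k" "x k \<le> 1" for k
      using norm_fourier_matrix_sq_le[of Q \<rho> c k] M unfolding x_def M_def by auto
    have g: "(norm (inverse_fourier g k))\<^sup>2 = (1 - x k) ^ (2 * N) * \<phi> k" for k
    proof -
      have "inverse_fourier g k = complex_of_real (1 - x k) ^ N * inverse_fourier f k"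
        unfolding g_def inverse_fourier_damping_funpow[OF f] x_def norm_fourier_matrix_sq M_def ..
      then have "norm (inverse_fourier g k) = \<bar>1 - x k\<bar> ^ N * norm (inverse_fourier f k)"
        by (simp only: norm_mult norm_power norm_of_real)
      then have "norm (inverse_fourier g k) = (1 - x k) ^ N * norm (inverse_fourier f k)"
        using x[of k] by simp
      then show ?thesis by (simp add: \<phi>_def power_mult_distrib power_mult mult.commute[of 2])
    qed
    have sets: "sets \<mu> = sets borel" using ft unfolding is_fourier_transform_def radon_measure_def by blast
    have int: "integrable \<mu> (\<lambda>k. (norm (inverse_fourier h k))\<^sup>2)" if "Cc h" for h
      using ft that unfolding is_fourier_transform_def by blast
    have S: "S \<in> sets \<mu>"
      unfolding sets S_def using closed_fourier_matrix_level by (rule borel_closed)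
    have pointwise: "indicator S k * \<phi> k \<le> 2 * (norm (inverse_fourier g k))\<^sup>2" for k
    proof (cases "k \<in> S")
      case True
      then have "x k \<le> \<theta>" unfolding S_def x_def \<theta>_def using M by (simp add: divide_right_mono)
      then have "real (2 * N) * x k \<le> real (2 * N) * \<theta>" by (intro mult_left_mono) auto
      also have "\<dots> \<le> 1 / 2" using N_le \<theta> by (simp add: field_simps)
      finally have "real (2 * N) * x k \<le> 1 / 2" .
      moreover have "1 + real (2 * N) * (- x k) \<le> (1 + (- x k)) ^ (2 * N)"
        by (rule Bernoulli_inequality) (use x[of k] in simp)
      ultimately have "1 / 2 \<le> (1 - x k) ^ (2 * N)" by simp
      then have "1 / 2 * \<phi> k \<le> (1 - x k) ^ (2 * N) * \<phi> k" by (intro mult_right_mono) (auto simp: \<phi>_def)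
      then show ?thesis using True g[of k] by simp
    qed simp
    have "(\<integral>k. indicator S k * \<phi> k \<partial>\<mu>) \<le> (\<integral>k. 2 * (norm (inverse_fourier g k))\<^sup>2 \<partial>\<mu>)"
    proof (rule integral_mono)
      show "integrable \<mu> (\<lambda>k. indicator S k * \<phi> k)"
        using integrable_mult_indicator[OF S int[OF f]] by (simp add: \<phi>_def)
      show "integrable \<mu> (\<lambda>k. 2 * (norm (inverse_fourier g k))\<^sup>2)"
        unfolding g_def by (intro integrable_mult_right int Cc_damping_funpow f)
    qed (rule pointwise)
    also have "\<dots> \<le> 2 * (C * M / (\<Delta> * real (2 * N + 1)))"
      using bound[OF Q QW, of N] unfolding g_def M_def \<Delta>_def by simp
    also have "\<dots> = 2 * C * M / \<Delta> * (1 / real (2 * N + 1))" by simp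
    also have "\<dots> \<le> 2 * C * M / \<Delta> * (4 * \<theta>)"
      using C M \<Delta> by (intro mult_left_mono N_ge) auto
    \<comment> \<open>The definition of \<open>\<theta>\<close> cancels \<open>M / \<Delta>\<close>,
      so no trace of the rule remains in the constant.\<close>
    also have "\<dots> = 8 * C * \<eta>" unfolding \<theta>_def using M \<Delta> by simp
    finally show "(\<integral>k. indicator {k. (norm (fourier_matrix Q \<rho> c k))\<^sup>2 \<le> \<eta> * \<bar>det Q\<bar>} k
         * (norm (inverse_fourier f k))\<^sup>2 \<partial>\<mu>) \<le> 8 * C * \<eta>"
      unfolding S_def \<Delta>_def \<phi>_def .
  qed
qed

text \<open>A nonnegative bump that is narrow compared with the wavelengths in question: all phases
  on its support have cosine at least 1/2, so nothing can cancel. Such functions detect the mass of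
  a measure on a given ball.\<close>

lemma inverse_fourier_nonzero_on_ball:
  assumes "R > 0"
  obtains f :: "real ^ 'd \<Rightarrow> complex" where "Cc f" "\<And>k. norm k \<le> R \<Longrightarrow> inverse_fourier f k \<noteq> 0"
proof
  \<comment> \<open>The support radius \<open>1 / (6 * R)\<close> makes the phase at most
    \<open>pi / 3\<close> for frequencies of norm up to \<open>R\<close>.\<close>
  define b where "b x = max 0 (1 - 6 * R * norm x)" for x :: "real ^ 'd"
  let ?f = "\<lambda>x. complex_of_real (b x)"
  have supp: "b x = 0" if "norm x > 1 / (6 * R)" for x
    using that assms unfolding b_def by (simp add: field_simps)
  have cont: "continuous_on UNIV b" unfolding b_def by (intro continuous_intros)
  show Cc: "Cc ?f"
    unfolding Cc_iff using supp cont by (auto intro!: continuous_intros)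
  have b_int: "integrable lborel b"
    using cont supp by (rule integrable_continuous_bounded_support)
  have b0: "b x \<ge> 0" for x unfolding b_def by simp
  have b_pos: "(\<integral>x. b x \<partial>lborel) > 0"
  proof -
    \<comment> \<open>At half the support radius the cone has height 1/2, which bounds its integral
      from below.\<close>
    let ?B = "ball (0 :: real ^ 'd) (1 / (12 * R))"
    have "0 < 1 / 2 * measure lborel ?B" using assms by simp
    also have "\<dots> = (\<integral>x. indicator ?B x * (1 / 2) \<partial>lborel)" by simp
    also have "\<dots> \<le> (\<integral>x. b x \<partial>lborel)"
    proof (rule integral_mono[OF _ b_int])
      show "integrable lborel (\<lambda>x. indicator ?B x * (1 / 2 :: real))"
        using emeasure_lborel_ball_finite[of "0 :: real ^ 'd" "1 / (12 * R)"]
        by (intro integrable_mult_left integrable_real_indicator) auto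
      show "indicator ?B x * (1 / 2) \<le> b x" for x
        using assms by (auto simp: indicator_def b_def field_simps)
    qed
    finally show ?thesis .
  qed
  show "inverse_fourier ?f k \<noteq> 0" if k: "norm k \<le> R" for k
  proof -
    have "integrable lborel (\<lambda>x. exp (2 * pi * \<i> * complex_of_real (k \<bullet> x)) * ?f x)"
      by (intro Cc_integrable Cc_mult_left[OF Cc] continuous_intros)
    then have "Re (inverse_fourier ?f k) = (\<integral>x. Re (exp (2 * pi * \<i> * complex_of_real (k \<bullet> x)) * ?f x) \<partial>lborel)"
      and int: "integrable lborel (\<lambda>x. Re (exp (2 * pi * \<i> * complex_of_real (k \<bullet> x)) * ?f x))"
      unfolding inverse_fourier_def by (auto simp del: times_complex.sel)
    moreover have "(\<integral>x. b x * (1 / 2) \<partial>lborel) \<le> (\<integral>x. Re (exp (2 * pi * \<i> * complex_of_real (k \<bullet> x)) * ?f x) \<partial>lborel)"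
    proof (rule integral_mono[OF _ int])
      show "integrable lborel (\<lambda>x. b x * (1 / 2))" using b_int by simp
      fix x
      have Re: "Re (exp (2 * pi * \<i> * complex_of_real (k \<bullet> x)) * ?f x) = b x * cos (2 * pi * (k \<bullet> x))"
        by (simp add: Re_exp)
      show "b x * (1 / 2) \<le> Re (exp (2 * pi * \<i> * complex_of_real (k \<bullet> x)) * ?f x)"
      proof (cases "norm x > 1 / (6 * R)")
        case False
        have "\<bar>k \<bullet> x\<bar> \<le> norm k * norm x" by (rule Cauchy_Schwarz_ineq2)
        also have "\<dots> \<le> R * (1 / (6 * R))" using False k assms by (intro mult_mono) auto
        also have "\<dots> = 1 / 6" using assms by simp
        finally have "\<bar>2 * pi * (k \<bullet> x)\<bar> \<le> pi / 3"
          using pi_gt_zero by (simp add: abs_mult field_simps)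
        then have "cos (pi / 3) \<le> cos \<bar>2 * pi * (k \<bullet> x)\<bar>"
          using pi_gt_zero by (intro cos_monotone_0_pi_le) auto
        then have "1 / 2 \<le> cos (2 * pi * (k \<bullet> x))" by (simp add: cos_60)
        then show ?thesis unfolding Re by (intro mult_left_mono b0)
      qed (simp add: Re supp)
    qed
    moreover have "(\<integral>x. b x * (1 / 2) \<partial>lborel) > 0" using b_pos by simp
    ultimately show ?thesis by force
  qed
qed

text \<open>Since \<open>ac_part\<close> is a definite description, uniqueness has to be shown as
  well: an absolutely continuous part has no mass on \<open>N\<close>, and on \<open>- N\<close> it
  is dominated by \<mu>.\<close>

lemma ac_part_singular:
  assumes sets: "sets \<mu> = sets borel" and N: "N \<in> null_sets lborel" "emeasure \<mu> (- N) = 0"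
  shows "ac_part \<mu> = null_measure borel"
  unfolding ac_part_def
proof (rule the_equality)
  have "lebesgue_decomposition \<mu> (null_measure borel) \<mu>"
    unfolding lebesgue_decomposition_def absolutely_continuous_def
    using sets N by (auto simp: null_sets_def)
  then show "\<exists>\<sigma>. lebesgue_decomposition \<mu> (null_measure borel) \<sigma>" ..
  fix \<alpha> assume "\<exists>\<sigma>. lebesgue_decomposition \<mu> \<alpha> \<sigma>"
  then obtain \<sigma> where dec: "sets \<alpha> = sets borel" "\<And>A. A \<in> sets borel \<Longrightarrow> emeasure \<mu> A = emeasure \<alpha> A + emeasure \<sigma> A"
    "absolutely_continuous lborel \<alpha>"
    unfolding lebesgue_decomposition_def by blast
  show "\<alpha> = null_measure borel"
  proof (rule measure_eqI)
    fix A assume "A \<in> sets \<alpha>"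
    then have A: "A \<in> sets borel" using dec(1) by simp
    have Nb: "N \<in> sets borel" using N(1) by auto
    have "N \<in> null_sets \<alpha>" using N(1) dec(3) unfolding absolutely_continuous_def by blast
    then have N0: "emeasure \<alpha> N = 0" by blast
    have "emeasure \<alpha> (- N) = 0" using dec(2)[of "- N"] N(2) Nb by auto
    then have "emeasure \<alpha> (N \<union> - N) \<le> 0"
      using emeasure_subadditive[of N \<alpha> "- N"] Nb dec(1) N0 by auto
    then have "emeasure \<alpha> A \<le> 0"
      using emeasure_mono[of A "N \<union> - N" \<alpha>] Nb dec(1) by (metis (no_types) Compl_partition order_trans sets.top
          sets_eq_imp_space_eq space_borel subset_UNIV)
    then show "emeasure \<alpha> A = emeasure (null_measure borel) A" by simp
  qed (simp add: dec)
qed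

lemma lyapunov_exponent_bound_eventually:
  assumes "lyapunov_exponent Q B k \<le> ereal (ln (sqrt \<Delta>) - \<epsilon>)" "\<epsilon> > 0" "\<Delta> > 0"
  shows "eventually (\<lambda>n. (norm (cocycle Q B n k))\<^sup>2 \<le> exp (- \<epsilon>) ^ n * \<Delta> ^ n) sequentially"
proof -
  \<comment> \<open>Half of \<epsilon> buys the strict inequality that is needed to pass from the
    limsup to large \<open>n\<close>. Squaring the norm doubles the other half, so the rate is
    \<open>exp (- \<epsilon>)\<close>.\<close>
  have "lyapunov_exponent Q B k < ereal (ln (sqrt \<Delta>) - \<epsilon> / 2)"
    using assms(1,2) by (auto intro: le_less_trans)
  then have "eventually (\<lambda>n. (if cocycle Q B n k = 0 then - \<infinity>
     else ereal (1 / real n * ln (norm (cocycle Q B n k)))) < ereal (ln (sqrt \<Delta>) - \<epsilon> / 2)) sequentially"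
    unfolding lyapunov_exponent_def by (rule Limsup_lessD)
  \<comment> \<open>Index 0 is excluded because \<open>1 / real 0\<close> is 0, so no bound on the
    norm could be read off there.\<close>
  then show ?thesis using eventually_gt_at_top[of 0]
  proof eventually_elim
    case (elim n)
    show ?case
    proof (cases "cocycle Q B n k = 0")
      case False
      let ?x = "norm (cocycle Q B n k)"
      have "1 / real n * ln ?x < ln \<Delta> / 2 - \<epsilon> / 2" using elim False assms(3) by (simp add: ln_sqrt)
      then have "2 * ln ?x \<le> real n * (- \<epsilon>) + real n * ln \<Delta>" using elim(2) by (simp add: field_simps)
      then have "exp (2 * ln ?x) \<le> exp (real n * (- \<epsilon>) + real n * ln \<Delta>)" by simp
      moreover have "exp (2 * ln ?x) = ?x\<^sup>2"
        using False by (simp add: exp_double exp_ln)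
      moreover have "exp (real n * (- \<epsilon>) + real n * ln \<Delta>) = exp (- \<epsilon>) ^ n * \<Delta> ^ n"
        using assms(3) unfolding exp_add exp_of_nat_mult by simp
      ultimately show ?thesis by simp
    qed (use assms(3) in simp)
  qed
qed

text \<open>It makes everything assumed about members of the hull available for the generating
  tiling.\<close>

lemma tiling_in_hull: "tiling T W \<Longrightarrow> W \<in> tiling_hull T c W"
proof -
  have "shift 0 W = W" unfolding shift_def by auto
  then have "rubber_close e (control_points c W) (control_points c (shift 0 W))" if "e > 0" for e
    using that unfolding rubber_close_def by (auto intro!: bexI centre_in_ball[THEN iffD2])
  then show "W \<in> tiling_hull T c W" if "tiling T W" using that unfolding tiling_hull_def by blast
qed

lemma inflate_funpow_mult:
  assumes "(inflate Q \<rho> ^^ m) W = W"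
  shows "(inflate Q \<rho> ^^ (m * l)) W = W"
  by (induction l) (auto simp: funpow_add assms)

theorem theorem5p7:
  fixes Q :: "real ^ 'd ^ 'd"
    and T :: "'n::finite \<Rightarrow> (real ^ 'd) set"
    and \<rho> :: "'n \<Rightarrow> ('n, 'd) patch"
    and c :: "'n \<Rightarrow> real ^ 'd"
    and W\<^sub>0 :: "('n, 'd) patch"
    and \<Upsilon> :: "'n \<Rightarrow> 'n \<Rightarrow> (real ^ 'd) measure"
    and diffraction :: "('n \<Rightarrow> complex) \<Rightarrow> (real ^ 'd) measure"
  assumes "inflation_rule Q T \<rho>"
    and "primitive_matrix (incidence_matrix \<rho>)"
    and "inflation_tiling Q T \<rho> W\<^sub>0"
    and "admissible_control_points T c W\<^sub>0"
    and "\<And>W i j. W \<in> tiling_hull T c W\<^sub>0 \<Longrightarrow> is_pair_correlation (control_points c W) i j (\<Upsilon> i j)"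
    and "\<And>W u. W \<in> tiling_hull T c W\<^sub>0 \<Longrightarrow>
           is_fourier_transform (autocorrelation (dens (\<Union>i. control_points c W i)) \<Upsilon> u) (diffraction u)"
    and "\<exists>k. det (fourier_matrix Q \<rho> c k) \<noteq> 0"
    and "\<exists>\<epsilon>>0. AE k in lborel.
           lyapunov_exponent Q (fourier_matrix Q \<rho> c) k \<le> ereal (ln (sqrt \<bar>det Q\<bar>) - \<epsilon>)"
  shows "\<forall>u. ac_part (diffraction u) = null_measure borel"
proof
  fix u
  let ?\<mu> = "diffraction u"
  let ?B = "\<lambda>n. cocycle Q (fourier_matrix Q \<rho> c) n"
  have reg: "regular_prototiles T" using assms(1) unfolding inflation_rule_def regular_prototiles_def by blast
  have Q: "dissection Q T \<rho>"
    using assms(1) expansive_imp_invertible unfolding inflation_rule_def dissection_def by blast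
  have \<Delta>: "\<bar>det Q\<bar> > 0" using Q unfolding dissection_def by (simp add: invertible_det_nz)
  have hull: "W\<^sub>0 \<in> tiling_hull T c W\<^sub>0"
    using assms(3) tiling_in_hull unfolding inflation_tiling_def by blast
  have W: "nonoverlapping T W\<^sub>0" using assms(3) unfolding inflation_tiling_def tiling_def by blast
  obtain m where m: "m > 0" "(inflate Q \<rho> ^^ m) W\<^sub>0 = W\<^sub>0"
    using assms(3) unfolding inflation_tiling_def by blast
  note corr = assms(5)[OF hull] and ft = assms(6)[OF hull, of u]
  have sets: "sets ?\<mu> = sets borel" using ft unfolding is_fourier_transform_def radon_measure_def by blast
  obtain \<epsilon> where \<epsilon>: "\<epsilon> > 0" and lyap: "AE k in lborel.
      lyapunov_exponent Q (fourier_matrix Q \<rho> c) k \<le> ereal (ln (sqrt \<bar>det Q\<bar>) - \<epsilon>)"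
    using assms(8) by blast
  define S where "S n = {k. (norm (?B n k))\<^sup>2 \<le> exp (- \<epsilon>) ^ n * \<bar>det Q\<bar> ^ n}" for n
  \<comment> \<open>The union of the sets \<open>G n\<^sub>0\<close> consists of the frequencies
    that lie in all but finitely many of the sets \<open>S n\<close>.\<close>
  define G where "G n\<^sub>0 = (\<Inter>n\<in>{n\<^sub>0..}. S n)" for n\<^sub>0
  have closed_S: "closed (S n)" for n
    unfolding S_def fourier_matrix_power[OF reg Q, symmetric] by (rule closed_fourier_matrix_level)
  have closed_G: "closed (G n)" for n unfolding G_def by (intro closed_INT ballI closed_S)
  \<comment> \<open>No single test function is known to have a transform without zeros, so the claim
    is proved ball by ball; \<open>Suc r\<close> keeps the radius positive.\<close>
  have "AE k in ?\<mu>. k \<notin> G n\<^sub>0 \<inter> cball 0 (real (Suc r))" for n\<^sub>0 r :: nat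
  proof -
    obtain f :: "real ^ 'd \<Rightarrow> complex" where f: "Cc f" "\<And>k. norm k \<le> real (Suc r) \<Longrightarrow> inverse_fourier f k \<noteq> 0"
      using inverse_fourier_nonzero_on_ball[of "real (Suc r)"] by auto
    define \<phi> where "\<phi> k = (norm (inverse_fourier f k))\<^sup>2" for k
    have int: "integrable ?\<mu> \<phi>" using ft f(1) unfolding is_fourier_transform_def \<phi>_def by blast
    obtain C where C: "\<forall>Q \<rho> \<eta>. dissection Q T \<rho> \<longrightarrow> inflate Q \<rho> W\<^sub>0 = W\<^sub>0 \<longrightarrow> \<eta> > 0 \<longrightarrow>
      (\<integral>k. indicator {k. (norm (fourier_matrix Q \<rho> c k))\<^sup>2 \<le> \<eta> * \<bar>det Q\<bar>} k
         * (norm (inverse_fourier f k))\<^sup>2 \<partial>?\<mu>) \<le> C * \<eta>"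
      using diffraction_level_bound[OF reg W corr ft f(1)] by (elim exE)
    have S_int: "(\<integral>k. indicator (S (m * l)) k * \<phi> k \<partial>?\<mu>) \<le> C * exp (- \<epsilon>) ^ (m * l)" for l
    proof -
      have "inflate (matrix_power Q (m * l)) (rule_power Q \<rho> (m * l)) W\<^sub>0 = W\<^sub>0"
        using inflate_funpow_mult[OF m(2), of l] unfolding inflate_funpow .
      from C[rule_format, OF dissection_power[OF Q] this, of "exp (- \<epsilon>) ^ (m * l)"] show ?thesis
        unfolding fourier_matrix_power[OF reg Q] det_matrix_power power_abs S_def \<phi>_def by simp
    qed
    let ?H = "\<lambda>A k. indicator A k * \<phi> k"
    have H_int: "integrable ?\<mu> (?H A)" if "closed A" for A
      using integrable_mult_indicator[OF _ int, of A] that by (simp add: sets)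
    have "(\<integral>k. ?H (G n\<^sub>0) k \<partial>?\<mu>) \<le> C * exp (- \<epsilon>) ^ (m * l)" if "l \<ge> n\<^sub>0" for l
    proof -
      \<comment> \<open>Only multiples of \<open>m\<close> give rules that fix
        \<open>W\<^sub>0\<close>. They suffice, because \<open>G n\<^sub>0\<close> lies in all later
        sets \<open>S n\<close>, and arbitrarily large multiples force the integral to 0.\<close>
      have "n\<^sub>0 \<le> m * l" using that m(1) by (metis One_nat_def Suc_leI le_trans mult_le_mono1 nat_mult_1)
      then have "G n\<^sub>0 \<subseteq> S (m * l)" unfolding G_def by auto
      then have "(\<integral>k. ?H (G n\<^sub>0) k \<partial>?\<mu>) \<le> (\<integral>k. ?H (S (m * l)) k \<partial>?\<mu>)"
        by (intro integral_mono H_int closed_G closed_S) (auto simp: indicator_def \<phi>_def)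
      then show ?thesis using S_int order_trans by blast
    qed
    moreover have "(\<lambda>l. C * exp (- \<epsilon>) ^ (m * l)) \<longlonglongrightarrow> C * 0"
      unfolding power_mult using \<epsilon> m(1) by (intro tendsto_intros LIMSEQ_power_zero) (simp add: power_less_one_iff)
    ultimately have "(\<integral>k. ?H (G n\<^sub>0) k \<partial>?\<mu>) \<le> C * 0"
      by (intro tendsto_lowerbound[where F = sequentially and f = "\<lambda>l. C * exp (- \<epsilon>) ^ (m * l)"])
        (auto simp: eventually_at_top_linorder)
    moreover have "(\<integral>k. ?H (G n\<^sub>0) k \<partial>?\<mu>) \<ge> 0" by (intro Bochner_Integration.integral_nonneg) (simp add: \<phi>_def)
    ultimately have "(\<integral>k. ?H (G n\<^sub>0) k \<partial>?\<mu>) = 0" by simp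
    then have "AE k in ?\<mu>. ?H (G n\<^sub>0) k = 0"
      using integral_nonneg_eq_0_iff_AE[OF H_int[OF closed_G]] by (simp add: \<phi>_def)
    then show ?thesis
    proof eventually_elim
      case (elim k)
      then show ?case using f(2)[of k] by (auto simp: \<phi>_def indicator_def)
    qed
  qed
  then have "AE k in ?\<mu>. \<forall>n\<^sub>0 r. k \<notin> G n\<^sub>0 \<inter> cball 0 (real (Suc r))" unfolding AE_all_countable by blast
  then have AE_G: "AE k in ?\<mu>. \<forall>n\<^sub>0. k \<notin> G n\<^sub>0"
  proof eventually_elim
    case (elim k)
    obtain r :: nat where "norm k \<le> real r" using real_arch_simple by blast
    then have "k \<in> cball 0 (real (Suc r))" by simp
    with elim show ?case by blast
  qed
  from lyap have "AE k in lborel. \<exists>n\<^sub>0. k \<in> G n\<^sub>0"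
  proof eventually_elim
    case (elim k)
    then show ?case
      using lyapunov_exponent_bound_eventually[OF elim \<epsilon> \<Delta>]
      unfolding G_def S_def eventually_sequentially by auto
  qed
  \<comment> \<open>Outside \<open>N\<close> every frequency lies in some
    \<open>G n\<^sub>0\<close>, and the diffraction gives no mass to any of these sets. So it is
    carried by the Lebesgue null set \<open>N\<close>.\<close>
  then obtain N where N: "{k \<in> space lborel. \<not> (\<exists>n\<^sub>0. k \<in> G n\<^sub>0)} \<subseteq> N" "emeasure lborel N = 0" "N \<in> sets lborel"
    by (rule AE_E)
  then have N_null: "N \<in> null_sets lborel" by blast
  have "AE k in ?\<mu>. k \<notin> - N" using AE_G
  proof eventually_elim
    case (elim k)
    then show ?case using N(1) by auto
  qed
  then have "emeasure ?\<mu> (- N) = 0"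
    using AE_iff_measurable[of "- N" ?\<mu> "\<lambda>k. k \<notin> - N"] N(3) sets sets_eq_imp_space_eq[OF sets] by auto
  then show "ac_part ?\<mu> = null_measure borel" by (rule ac_part_singular[OF sets N_null])
qed

end
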